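(* In the setting described in the context, the nonholonomic Euler--Poincar\'e equations $$\frac{d}{dt}\left(\frac{\delta\ell}{\delta\xi}\right)=\operatorname{ad}_\xi^*\frac{\delta\ell}{\delta\xi}+\mathbf K\left(\frac{\delta\ell}{\delta\Gamma},\Gamma\right)+\lambda_a\psi^a(\Gamma),\qquad \dot\Gamma=-\xi\Gamma,\qquad \xi(t)\in\mathfrak d(\Gamma(t)),$$ with Lagrange multipliers $\{\lambda_a\}_{a=1}^r$, are written in coordinates as $$\dot p_\alpha=-\mathcal B^i_{\alpha\beta}(\Gamma)\,p_i\,v^\beta+\mathcal K^k_{\alpha j}\left.\frac{\partial\ell}{\partial\Gamma_j}\right|_{\rm c}\Gamma_k,\qquad \dot\Gamma_i=-\varkappa^k_{i\beta}(\Gamma)\,v^\beta\,\Gamma_k .$$ That is, a curve $t\mapsto(\xi(t),\Gamma(t))$ with $\xi(t)=v^\alpha(t)\,\mathcal E_\alpha(\Gamma(t))\in\mathfrak d(\Gamma(t))$ satisfies the former equations for some multipliers $\lambda_a(t)$ if and only if $(v^\alpha(t),\Gamma(t))$ satisfies the latter for all $\alpha\in\{1,\dots,n-r\}$ and $i\in\{1,\dots,\dim X\}$. Here $$\mathcal K^k_{ij}:=\langle\mathbf K(\mathbf e_j,\mathbf e^k_* ),\mathcal E_i\rangle,\qquad \varkappa^k_{i\beta}(\Gamma):=\kappa^k_{ij}\,\mathcal E^j_\beta(\Gamma),$$ $$\mathcal B^i_{\alpha\beta}(\Gamma):=\mathcal C^i_{\alpha\beta}(\Gamma)+\mathcal F^i_{\alpha\beta}(\Gamma),\qquad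 \mathcal F^i_{\alpha\beta}(\Gamma):=D^j\mathcal E^l_\alpha(\Gamma)\,(\mathcal E^{-1})^i_l(\Gamma)\,\varkappa^k_{j\beta}(\Gamma)\,\Gamma_k,$$ and $D^j\mathcal E^i_\alpha$ stands for $\partial\mathcal E^i_\alpha/\partial\Gamma_j$.
   Context: Einstein's summation convention is used. $\mathfrak s$ is the Lie algebra, of dimension $n$, of a Lie group $\mathsf S$ that has a linear representation on a finite-dimensional real vector space $X$. The induced actions of $\xi\in\mathfrak s$ are $\xi\mathsf x:=\frac{d}{d\varepsilon}\big|_{\varepsilon=0}\exp(\varepsilon\xi)\mathsf x$ on $X$ and, on the dual $X^*$, $\langle\xi\gamma,\mathsf x\rangle=-\langle\gamma,\xi\mathsf x\rangle$. The map $\mathbf K\colon X\times X^*\to\mathfrak s^*$ is defined by $\langle\mathbf K(\mathsf x,\Gamma),\xi\rangle=\langle\Gamma,\xi\mathsf x\rangle=-\langle\xi\Gamma,\mathsf x\rangle$. $\operatorname{ad}_\xi\eta=[\xi,\eta]$ and $\langle\operatorname{ad}^*_\xi\mu,\eta\rangle=\langle\mu,\operatorname{ad}_\xi\eta\rangle$. For smooth $f\colon E\to\mathbb R$ on a vector space, $\delta f/\delta x\in E^*$ is the derivative: $\langle\delta f/\delta x,\delta x\rangle=\frac{d}{d\varepsilon}\big|_{\varepsilon=0}f(x+\varepsilon\,\delta x)$. $\ell\colon\mathfrak s\times X^*\to\mathbb R$ is a smooth reduced Lagrangian, and $\psi^a\colon X^*\to\mathfrak s^*$, $a=1,\dots,r$,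 are smooth maps defining the $\Gamma$-dependent constraint subspace $\mathfrak d(\Gamma)=\bigcap_{a=1}^r\ker\psi^a(\Gamma)\subset\mathfrak s$, whose annihilator is $\mathfrak d^\circ(\Gamma)=\operatorname{span}\{\psi^a(\Gamma)\}_{a=1}^r$. **$\Gamma$-dependent basis and quasivelocities.** One has a decomposition $\mathfrak s=\mathfrak d(\Gamma)\oplus\mathfrak v(\Gamma)$ with a basis $\{\mathcal E_i(\Gamma)\}_{i=1}^n$ of $\mathfrak s$ depending smoothly on $\Gamma$, such that $\mathfrak d(\Gamma)=\operatorname{span}\{\mathcal E_\alpha(\Gamma)\}_{\alpha=1}^{n-r}$ and $\mathfrak v(\Gamma)$ is spanned by the remaining $r$ basis elements. Greek indices run over $1,\dots,n-r$ (the $\mathfrak d$ part); indices $i,j,k,l,\dots$ of $\mathfrak s$-type run over $1,\dots,n$; indices on $\Gamma$-components run over $1,\dots,\dim X$. Writing $\xi=v^i\mathcal E_i(\Gamma)$, the coefficients $v^i$ are the quasivelocities; $\xi\in\mathfrak d(\Gamma)$ iff $\xi=v^\alpha\mathcal E_\alpha(\Gamma)$. Fix a $\Gamma$-independent basis $\{E_i\}_{i=1}^n$ of $\mathfrak s$ with $[E_i,E_j]=c^k_{ij}E_k$ and write $\xi=\xi^iE_i$. Write $\mathcal E_j(\Gamma)=\mathcal E^i_j(\Gamma)E_i$ and $E_i=(\mathcal E^{-1})^j_i(\Gamma)\mathcal E_j(\Gamma)$. The $\Gamma$-dependent structure constants are given by $[\mathcal E_i(\Gamma),\mathcal E_j(\Gamma)]=\mathcal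 C^k_{ij}(\Gamma)\mathcal E_k(\Gamma)$, i.e. $\mathcal C^k_{ij}=\mathcal E^l_i\mathcal E^m_jc^p_{lm}(\mathcal E^{-1})^k_p$. $\{\mathbf e_i\}$ is a basis of $X$ and $\{\mathbf e^i_*\}$ its dual basis of $X^*$; $\Gamma=\Gamma_i\mathbf e^i_*$, and the constants $\kappa^k_{ij}$ are defined by $\xi\Gamma=\kappa^k_{ij}\,\xi^j\,\Gamma_k\,\mathbf e^i_*$. The subscript $(\,\cdot\,)|_{\rm c}$ means that the constraint $\xi\in\mathfrak d(\Gamma)$ (i.e. $\xi=v^\alpha\mathcal E_\alpha(\Gamma)$) is applied after computing the expression. Define $\mu:=\frac{\delta\ell}{\delta\xi}\big|_{\rm c}\in\mathfrak s^*$ and $p_i:=\langle\mu,\mathcal E_i(\Gamma)\rangle$ for $i=1,\dots,n$; thus each $p_i$ is a function of $(v^\alpha,\Gamma)$. *)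

theory Defs
  imports "HOL-Analysis.Analysis" "HOL-Algebra.Group"
begin

text \<open>
  Only meant for open \<open>S\<close> in a finite-dimensional space. There, \<open>f\<close> is of class \<open>C\<^sup>k\<^sup>+\<^sup>1\<close> iff
  it is differentiable and all its directional derivatives are of class \<open>C\<^sup>k\<close>.
\<close>

primrec Ck_on :: "nat \<Rightarrow> 'a::real_normed_vector set \<Rightarrow> ('a \<Rightarrow> 'b::real_normed_vector) \<Rightarrow> bool" where
  "Ck_on 0 S f \<longleftrightarrow> continuous_on S f"
| "Ck_on (Suc k) S f \<longleftrightarrow>
     f differentiable_on S \<and> (\<forall>h. Ck_on k S (\<lambda>x. frechet_derivative f (at x) h))"

definition smooth_on :: "'a::real_normed_vector set \<Rightarrow> ('a \<Rightarrow> 'b::real_normed_vector) \<Rightarrow> bool" where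
  "smooth_on S f \<longleftrightarrow> (\<forall>k. Ck_on k S f)"

text \<open>
  A Lie group is modelled on a Euclidean space \<open>'s\<close>. One chart around the identity is singled
  out: it identifies the tangent space at the identity with \<open>'s\<close>, so that \<open>'s\<close> serves as the
  (underlying vector space of the) Lie algebra. Charts are pairs of a domain and a map, the map
  being irrelevant outside the domain.
\<close>

record ('g, 's) lie_group_data = "'g monoid" +
  gtop :: "'g topology"
  atlas :: "('g set \<times> ('g \<Rightarrow> 's)) set"
  id_chart :: "'g set \<times> ('g \<Rightarrow> 's)"

locale lie_group = group G for G :: "('g, 's::euclidean_space) lie_group_data" (structure) +
  assumes topspace_gtop: "topspace (gtop G) = carrier G"
    and Hausdorff: "Hausdorff_space (gtop G)"
    and second_countable: "second_countable (gtop G)"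
    and chart: "(U, \<phi>) \<in> atlas G \<Longrightarrow>
      openin (gtop G) U \<and> open (\<phi> ` U) \<and>
      homeomorphic_map (subtopology (gtop G) U) (top_of_set (\<phi> ` U)) \<phi>"
    and atlas_cover: "(\<Union>(U, \<phi>) \<in> atlas G. U) = carrier G"
    and transition_smooth: "(U, \<phi>) \<in> atlas G \<Longrightarrow> (V, \<theta>) \<in> atlas G \<Longrightarrow>
      smooth_on (\<phi> ` (U \<inter> V)) (\<theta> \<circ> inv_into U \<phi>)"
    and mult_continuous:
      "continuous_map (prod_topology (gtop G) (gtop G)) (gtop G) (\<lambda>(g, h). g \<otimes> h)"
    and inv_continuous: "continuous_map (gtop G) (gtop G) (\<lambda>g. inv g)"
    and mult_smooth: "(U, \<phi>) \<in> atlas G \<Longrightarrow> (V, \<theta>) \<in> atlas G \<Longrightarrow> (W, \<omega>) \<in> atlas G \<Longrightarrow>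
      smooth_on {(x, y). x \<in> \<phi> ` U \<and> y \<in> \<theta> ` V \<and> inv_into U \<phi> x \<otimes> inv_into V \<theta> y \<in> W}
        (\<lambda>(x, y). \<omega> (inv_into U \<phi> x \<otimes> inv_into V \<theta> y))"
    and inv_smooth: "(U, \<phi>) \<in> atlas G \<Longrightarrow> (W, \<omega>) \<in> atlas G \<Longrightarrow>
      smooth_on {x. x \<in> \<phi> ` U \<and> inv (inv_into U \<phi> x) \<in> W} (\<lambda>x. \<omega> (inv (inv_into U \<phi> x)))"
    and id_chart: "id_chart G \<in> atlas G" "\<one> \<in> fst (id_chart G)"

definition to_coord :: "('g, 's) lie_group_data \<Rightarrow> 'g \<Rightarrow> 's" where
  "to_coord G = snd (id_chart G)"

definition of_coord :: "('g, 's) lie_group_data \<Rightarrow> 's \<Rightarrow> 'g" where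
  "of_coord G = inv_into (fst (id_chart G)) (snd (id_chart G))"

text \<open>The left-invariant vector field with value \<open>\<xi>\<close> at the identity, in the identity chart.\<close>

definition left_inv_field ::
  "('g, 's::euclidean_space) lie_group_data \<Rightarrow> 's \<Rightarrow> 's \<Rightarrow> 's" where
  "left_inv_field G \<xi> x =
     frechet_derivative (\<lambda>y. to_coord G (of_coord G x \<otimes>\<^bsub>G\<^esub> of_coord G y))
       (at (to_coord G \<one>\<^bsub>G\<^esub>)) \<xi>"

text \<open>
  The Jacobi--Lie bracket \<open>[X, Y] = DY X - DX Y\<close> of left-invariant vector fields, evaluated at
  the identity.
\<close>

definition lie_bracket :: "('g, 's::euclidean_space) lie_group_data \<Rightarrow> 's \<Rightarrow> 's \<Rightarrow> 's" where
  "lie_bracket G \<xi> \<eta> =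
     frechet_derivative (left_inv_field G \<eta>) (at (to_coord G \<one>\<^bsub>G\<^esub>)) \<xi> -
     frechet_derivative (left_inv_field G \<xi>) (at (to_coord G \<one>\<^bsub>G\<^esub>)) \<eta>"

text \<open>
  The exponential map, characterized (uniquely) by the one-parameter subgroups \<open>t \<mapsto> ex (t \<xi>)\<close>.
  Continuity is needed because \<open>to_coord G\<close> is arbitrary outside the chart domain.
\<close>

definition is_lie_exp ::
  "('g, 's::euclidean_space) lie_group_data \<Rightarrow> ('s \<Rightarrow> 'g) \<Rightarrow> bool" where
  "is_lie_exp G ex \<longleftrightarrow> (\<forall>\<xi>.
     continuous_map euclideanreal (gtop G) (\<lambda>t. ex (t *\<^sub>R \<xi>)) \<and>
     (\<forall>s t. ex ((s + t) *\<^sub>R \<xi>) = ex (s *\<^sub>R \<xi>) \<otimes>\<^bsub>G\<^esub> ex (t *\<^sub>R \<xi>)) \<and>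
     ((\<lambda>t. to_coord G (ex (t *\<^sub>R \<xi>))) has_vector_derivative \<xi>) (at 0))"

definition lie_group_representation ::
  "('g, 's::euclidean_space) lie_group_data \<Rightarrow> ('g \<Rightarrow> 'x::euclidean_space \<Rightarrow> 'x) \<Rightarrow> bool" where
  "lie_group_representation G \<rho> \<longleftrightarrow>
     (\<forall>g \<in> carrier G. linear (\<rho> g)) \<and>
     \<rho> \<one>\<^bsub>G\<^esub> = id \<and>
     (\<forall>g \<in> carrier G. \<forall>h \<in> carrier G. \<rho> (g \<otimes>\<^bsub>G\<^esub> h) = \<rho> g \<circ> \<rho> h) \<and>
     (\<forall>x. \<forall>(U, \<phi>) \<in> atlas G. smooth_on (\<phi> ` U) (\<lambda>y. \<rho> (inv_into U \<phi> y) x))"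

definition induced_action ::
  "('s::euclidean_space \<Rightarrow> 'g) \<Rightarrow> ('g \<Rightarrow> 'x::euclidean_space \<Rightarrow> 'x) \<Rightarrow> 's \<Rightarrow> 'x \<Rightarrow> 'x" where
  "induced_action ex \<rho> \<xi> x = vector_derivative (\<lambda>\<epsilon>. \<rho> (ex (\<epsilon> *\<^sub>R \<xi>)) x) (at 0)"

text \<open>In the next three definitions, \<open>act\<close> is the induced action and \<open>br\<close> the Lie bracket.\<close>

definition dual_action ::
  "('s \<Rightarrow> 'x \<Rightarrow> 'x) \<Rightarrow> 's \<Rightarrow> ('x::euclidean_space \<Rightarrow>\<^sub>L real) \<Rightarrow> ('x \<Rightarrow>\<^sub>L real)" where
  "dual_action act \<xi> \<gamma> = Blinfun (\<lambda>x. - blinfun_apply \<gamma> (act \<xi> x))"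

definition K_map ::
  "('s \<Rightarrow> 'x \<Rightarrow> 'x) \<Rightarrow> 'x \<Rightarrow> ('x::euclidean_space \<Rightarrow>\<^sub>L real) \<Rightarrow> ('s::euclidean_space \<Rightarrow>\<^sub>L real)" where
  "K_map act x \<Gamma> = Blinfun (\<lambda>\<xi>. blinfun_apply \<Gamma> (act \<xi> x))"

definition ad_star ::
  "('s \<Rightarrow> 's \<Rightarrow> 's) \<Rightarrow> 's \<Rightarrow> ('s::euclidean_space \<Rightarrow>\<^sub>L real) \<Rightarrow> ('s \<Rightarrow>\<^sub>L real)" where
  "ad_star br \<xi> \<mu> = Blinfun (\<lambda>\<eta>. blinfun_apply \<mu> (br \<xi> \<eta>))"

definition fderiv :: "('a::real_normed_vector \<Rightarrow> real) \<Rightarrow> 'a \<Rightarrow> ('a \<Rightarrow>\<^sub>L real)" where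
  "fderiv f x = Blinfun (\<lambda>\<delta>x. deriv (\<lambda>\<epsilon>. f (x + \<epsilon> *\<^sub>R \<delta>x)) 0)"

text \<open>The canonical identification of the bidual of a finite-dimensional space with the space.\<close>

definition of_bidual :: "(('x::euclidean_space \<Rightarrow>\<^sub>L real) \<Rightarrow>\<^sub>L real) \<Rightarrow> 'x" where
  "of_bidual \<Phi> = (THE x. \<forall>\<gamma>. blinfun_apply \<Phi> \<gamma> = blinfun_apply \<gamma> x)"

definition constraint_space ::
  "(nat \<Rightarrow> 'c \<Rightarrow> ('s::euclidean_space \<Rightarrow>\<^sub>L real)) \<Rightarrow> nat \<Rightarrow> 'c \<Rightarrow> 's set" where
  "constraint_space \<psi> r \<Gamma> = (\<Inter>a \<in> {1..r}. {\<xi>. blinfun_apply (\<psi> a \<Gamma>) \<xi> = 0})"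

definition indexed_basis :: "nat \<Rightarrow> (nat \<Rightarrow> 'a::real_vector) \<Rightarrow> bool" where
  "indexed_basis N b \<longleftrightarrow>
     inj_on b {1..N} \<and> independent (b ` {1..N}) \<and> span (b ` {1..N}) = UNIV"

definition coord :: "nat \<Rightarrow> (nat \<Rightarrow> 'a::real_vector) \<Rightarrow> 'a \<Rightarrow> nat \<Rightarrow> real" where
  "coord N b x i = representation (b ` {1..N}) x (b i)"

definition dual_basis :: "nat \<Rightarrow> (nat \<Rightarrow> 'a::real_normed_vector) \<Rightarrow> nat \<Rightarrow> ('a \<Rightarrow>\<^sub>L real)" where
  "dual_basis N b i = Blinfun (\<lambda>x. coord N b x i)"

end

theory Submission
  imports Defs
begin

text \<open>
  Along a curve with \<open>\<xi> t \<in> \<dd>(\<Gamma> t)\<close>, write \<open>\<mu>\<close> for the momentum and \<open>F\<close> for the right-hand side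
  \<open>ad\<^sup>*\<^sub>\<xi> \<mu> + K\<close> without multipliers. Since the annihilator of \<open>\<dd>(\<Gamma>)\<close> is spanned by the \<open>\<psi>\<^sup>a(\<Gamma>)\<close>,
  multipliers exist iff the derivative of \<open>\<mu>\<close> agrees with \<open>F\<close> on the vectors \<open>\<E>\<^sub>\<alpha>(\<Gamma>)\<close>. By the
  product rule, the derivative of \<open>p\<^sub>\<alpha> = \<mu>(\<E>\<^sub>\<alpha>(\<Gamma>))\<close> differs from \<open>\<mu>'(\<E>\<^sub>\<alpha>(\<Gamma>))\<close> by \<open>\<mu>\<close> applied to the
  derivative of \<open>\<E>\<^sub>\<alpha>(\<Gamma>)\<close> along \<open>\<Gamma>' = -\<xi>\<Gamma>\<close>, and this extra term is the source of \<open>\<F>\<close> in \<open>\<B>\<close>.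
  The bilinearity of the bracket and of the induced action, needed for the expansion in bases, comes
  from the smoothness of multiplication and representation in the chart around the identity.
\<close>

declare One_nat_def [simp del]

section \<open>Coordinates in indexed bases, dual bases and the bidual\<close>

lemma indexed_basis_representation:
  assumes "indexed_basis N b"
  shows "(\<Sum>i=1..N. coord N b x i *\<^sub>R b i) = x"
proof -
  have inj: "inj_on b {1..N}" and ind: "independent (b ` {1..N})" and sp: "span (b ` {1..N}) = UNIV"
    using assms by (auto simp: indexed_basis_def)
  have "(\<Sum>i=1..N. coord N b x i *\<^sub>R b i) = (\<Sum>u\<in>b ` {1..N}. representation (b ` {1..N}) x u *\<^sub>R u)"
    by (simp add: sum.reindex[OF inj] coord_def)
  also have "\<dots> = x"
    using ind sp by (intro real_vector.sum_representation_eq) auto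
  finally show ?thesis .
qed

lemma linear_coord:
  assumes "indexed_basis N b"
  shows "linear (\<lambda>x. coord N b x i)"
  using assms unfolding coord_def indexed_basis_def
  by (intro linearI) (auto simp: real_vector.representation_add real_vector.representation_scale)

lemma coord_basis:
  assumes "indexed_basis N b" "i \<in> {1..N}" "j \<in> {1..N}"
  shows "coord N b (b j) i = (if i = j then 1 else 0)"
proof -
  have "representation (b ` {1..N}) (b j) = (\<lambda>v. if v = b j then 1 else 0)"
    using assms by (intro real_vector.representation_basis) (auto simp: indexed_basis_def)
  moreover have "b i = b j \<longleftrightarrow> i = j"
    using assms by (intro inj_on_eq_iff[of b "{1..N}"]) (auto simp: indexed_basis_def)
  ultimately show ?thesis
    by (simp add: coord_def)
qed

lemma coord_sum_scaleR:
  assumes "indexed_basis N b"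
  shows "coord N b (\<Sum>x\<in>A. c x *\<^sub>R f x) i = (\<Sum>x\<in>A. c x * coord N b (f x) i)"
  by (simp add: linear_sum[OF linear_coord[OF assms]] linear_scale[OF linear_coord[OF assms]])

lemma coord_sum_basis:
  assumes "indexed_basis N b" "i \<in> {1..N}"
  shows "coord N b (\<Sum>j=1..N. c j *\<^sub>R b j) i = c i"
proof -
  have "coord N b (\<Sum>j=1..N. c j *\<^sub>R b j) i = (\<Sum>j=1..N. c j * coord N b (b j) i)"
    by (rule coord_sum_scaleR[OF assms(1)])
  also have "\<dots> = (\<Sum>j=1..N. if i = j then c j else 0)"
    using assms by (intro sum.cong) (auto simp: coord_basis)
  also have "\<dots> = c i" using assms(2) by simp
  finally show ?thesis .
qed

lemma dual_basis_apply:
  fixes b :: "nat \<Rightarrow> 'a::euclidean_space"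
  assumes "indexed_basis N b"
  shows "blinfun_apply (dual_basis N b i) x = coord N b x i"
  using linear_coord[OF assms]
  by (simp add: dual_basis_def bounded_linear_Blinfun_apply linear_conv_bounded_linear)

lemma blinfun_eq_sum_dual_basis:
  fixes b :: "nat \<Rightarrow> 'a::euclidean_space" and \<gamma> :: "'a \<Rightarrow>\<^sub>L real"
  assumes "indexed_basis N b"
  shows "\<gamma> = (\<Sum>i=1..N. blinfun_apply \<gamma> (b i) *\<^sub>R dual_basis N b i)"
proof (rule blinfun_eqI)
  fix x
  have "blinfun_apply \<gamma> x = blinfun_apply \<gamma> (\<Sum>i=1..N. coord N b x i *\<^sub>R b i)"
    by (simp only: indexed_basis_representation[OF assms])
  also have "\<dots> = (\<Sum>i=1..N. coord N b x i * blinfun_apply \<gamma> (b i))"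
    by (simp add: blinfun.sum_right blinfun.scaleR_right)
  finally show "blinfun_apply \<gamma> x = blinfun_apply (\<Sum>i=1..N. blinfun_apply \<gamma> (b i) *\<^sub>R dual_basis N b i) x"
    by (simp add: blinfun.sum_left blinfun.scaleR_left dual_basis_apply[OF assms] mult.commute)
qed

text \<open>Evaluation at \<open>b j\<close> isolates the \<open>j\<close>-th coefficient of a
  combination of dual vectors, which gives injectivity and independence; spanning is the expansion
  \<open>blinfun_eq_sum_dual_basis\<close>.\<close>

lemma indexed_basis_dual_basis:
  fixes b :: "nat \<Rightarrow> 'a::euclidean_space"
  assumes b: "indexed_basis N b"
  shows "indexed_basis N (dual_basis N b)"
proof -
  have ev: "blinfun_apply (dual_basis N b i) (b j) = (if i = j then 1 else 0)"
    if "i \<in> {1..N}" "j \<in> {1..N}" for i j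
    using that by (simp add: dual_basis_apply[OF b] coord_basis[OF b])
  have inj: "inj_on (dual_basis N b) {1..N}"
  proof (rule inj_onI)
    fix i j assume ij: "i \<in> {1..N}" "j \<in> {1..N}" "dual_basis N b i = dual_basis N b j"
    then show "i = j" using ev[of i i] ev[of j i] by (metis zero_neq_one)
  qed
  have "independent (dual_basis N b ` {1..N})"
  proof (rule real_vector.independent_if_scalars_zero)
    fix f x
    assume s: "(\<Sum>x\<in>dual_basis N b ` {1..N}. f x *\<^sub>R x) = 0" and x: "x \<in> dual_basis N b ` {1..N}"
    then obtain j where j: "j \<in> {1..N}" "x = dual_basis N b j" by auto
    have "0 = blinfun_apply (\<Sum>i=1..N. f (dual_basis N b i) *\<^sub>R dual_basis N b i) (b j)"
      using s by (simp add: sum.reindex[OF inj])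
    also have "\<dots> = (\<Sum>i=1..N. if i = j then f (dual_basis N b i) else 0)"
      unfolding blinfun.sum_left blinfun.scaleR_left using j(1) by (intro sum.cong) (auto simp: ev)
    also have "\<dots> = f x" using j by simp
    finally show "f x = 0" by simp
  qed auto
  moreover have "\<gamma> \<in> span (dual_basis N b ` {1..N})" for \<gamma>
    by (subst blinfun_eq_sum_dual_basis[OF b, of \<gamma>])
       (intro span_sum span_scale span_base imageI)
  ultimately show ?thesis using inj by (auto simp: indexed_basis_def)
qed

text \<open>This turns the components of \<Gamma> into evaluations at basis vectors of X, which are
  bounded linear in \<Gamma> and so compatible with derivatives.\<close>

lemma coord_dual_basis:
  fixes b :: "nat \<Rightarrow> 'a::euclidean_space"
  assumes b: "indexed_basis N b" and i: "i \<in> {1..N}"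
  shows "coord N (dual_basis N b) \<gamma> i = blinfun_apply \<gamma> (b i)"
  using coord_sum_basis[OF indexed_basis_dual_basis[OF b] i, of "\<lambda>i. blinfun_apply \<gamma> (b i)"]
  by (simp only: blinfun_eq_sum_dual_basis[OF b, of \<gamma>, symmetric])

text \<open>Expanding a covector in the dual basis shows that the displayed vector represents
  \<open>\<Phi>\<close>. Uniqueness, as \<open>THE\<close> demands, holds because the dual basis
  reads off all coordinates of a representing vector.\<close>

lemma of_bidual_eq:
  fixes b :: "nat \<Rightarrow> 'x::euclidean_space"
  assumes b: "indexed_basis N b"
  shows "of_bidual \<Phi> = (\<Sum>i=1..N. blinfun_apply \<Phi> (dual_basis N b i) *\<^sub>R b i)"
  unfolding of_bidual_def
proof (rule the_equality)
  show *: "\<forall>\<gamma>. blinfun_apply \<Phi> \<gamma> = blinfun_apply \<gamma> (\<Sum>i=1..N. blinfun_apply \<Phi> (dual_basis N b i) *\<^sub>R b i)"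
  proof
    fix \<gamma> :: "'x \<Rightarrow>\<^sub>L real"
    have "blinfun_apply \<Phi> \<gamma> = blinfun_apply \<Phi> (\<Sum>i=1..N. blinfun_apply \<gamma> (b i) *\<^sub>R dual_basis N b i)"
      by (simp only: blinfun_eq_sum_dual_basis[OF b, of \<gamma>, symmetric])
    then show "blinfun_apply \<Phi> \<gamma> = blinfun_apply \<gamma> (\<Sum>i=1..N. blinfun_apply \<Phi> (dual_basis N b i) *\<^sub>R b i)"
      by (simp add: blinfun.sum_right blinfun.scaleR_right mult.commute)
  qed
  fix x assume x: "\<forall>\<gamma>. blinfun_apply \<Phi> \<gamma> = blinfun_apply \<gamma> x"
  have "x = (\<Sum>i=1..N. coord N b x i *\<^sub>R b i)" by (simp add: indexed_basis_representation[OF b])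
  also have "\<dots> = (\<Sum>i=1..N. blinfun_apply \<Phi> (dual_basis N b i) *\<^sub>R b i)"
    using x by (simp add: dual_basis_apply[OF b])
  finally show "x = (\<Sum>i=1..N. blinfun_apply \<Phi> (dual_basis N b i) *\<^sub>R b i)" .
qed

text \<open>After identifying functionals with vectors, the constraint space is the orthogonal
  complement of the span of the vectors \<open>?u a\<close>. The component \<open>z\<close> of
  \<open>riesz f\<close> orthogonal to that span lies in the constraint space, so \<open>f\<close>
  vanishes on it; as \<open>f\<close> at \<open>z\<close> is the squared norm of \<open>z\<close>,
  only the part in the span remains.\<close>

lemma annihilator_of_constraint_space:
  fixes \<psi> :: "nat \<Rightarrow> 'c \<Rightarrow> ('s::euclidean_space \<Rightarrow>\<^sub>L real)"
  assumes f: "\<And>x. x \<in> constraint_space \<psi> r \<gamma> \<Longrightarrow> blinfun_apply f x = 0"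
  shows "\<exists>c. f = (\<Sum>a=1..r. c a *\<^sub>R \<psi> a \<gamma>)"
proof -
  define riesz where "riesz g = (\<Sum>b\<in>Basis. blinfun_apply g b *\<^sub>R b)" for g :: "'s \<Rightarrow>\<^sub>L real"
  have riesz: "blinfun_apply g x = riesz g \<bullet> x" for g x
    by (subst euclidean_representation[of x, symmetric])
       (simp add: riesz_def blinfun.sum_right blinfun.scaleR_right inner_sum_left inner_sum_right
         inner_commute mult.commute)
  let ?u = "\<lambda>a. riesz (\<psi> a \<gamma>)"
  have "riesz f \<in> span (?u ` {1..r})"
  proof -
    obtain y z where yz: "y \<in> span (?u ` {1..r})" "\<And>w. w \<in> span (?u ` {1..r}) \<Longrightarrow> orthogonal z w"
      "riesz f = y + z"
      using orthogonal_subspace_decomp_exists[of "?u ` {1..r}" "riesz f"] by blast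
    have "z \<in> constraint_space \<psi> r \<gamma>"
      using yz(2)[OF span_base[OF imageI]]
      by (auto simp: constraint_space_def riesz orthogonal_def inner_commute[of z])
    then have "(y + z) \<bullet> z = 0" using f by (simp add: riesz yz(3)[symmetric])
    moreover have "y \<bullet> z = 0" using yz by (auto simp: orthogonal_def inner_commute)
    ultimately have "z = 0" by (simp add: inner_add_left)
    then show ?thesis using yz by simp
  qed
  \<comment> \<open>The multipliers are indexed by \<open>a\<close>, whereas a span only sees the
    set of vectors, in which different indices may coincide. Indexed combinations form a subspace
    containing every \<open>?u a\<close>, hence the span.\<close>
  also have "span (?u ` {1..r}) \<subseteq> range (\<lambda>c. \<Sum>a=1..r. c a *\<^sub>R ?u a)"
  proof (rule span_minimal)
    show "?u ` {1..r} \<subseteq> range (\<lambda>c. \<Sum>a=1..r. c a *\<^sub>R ?u a)"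
    proof
      fix x assume "x \<in> ?u ` {1..r}"
      then obtain a where "a \<in> {1..r}" "x = ?u a" by auto
      then have "x = (\<Sum>a'=1..r. if a' = a then ?u a' else 0)" by simp
      also have "\<dots> = (\<Sum>a'=1..r. (if a' = a then 1 else 0) *\<^sub>R ?u a')"
        by (intro sum.cong) auto
      finally have "x = (\<Sum>a'=1..r. (if a' = a then 1 else 0) *\<^sub>R ?u a')" .
      then show "x \<in> range (\<lambda>c. \<Sum>a=1..r. c a *\<^sub>R ?u a)" by auto
    qed
    show "subspace (range (\<lambda>c. \<Sum>a=1..r. c a *\<^sub>R ?u a))"
    proof (rule subspaceI)
      show "0 \<in> range (\<lambda>c. \<Sum>a=1..r. c a *\<^sub>R ?u a)"
        by (rule range_eqI[of _ _ "\<lambda>_. 0"]) simp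
    next
      fix x y assume "x \<in> range (\<lambda>c. \<Sum>a=1..r. c a *\<^sub>R ?u a)" "y \<in> range (\<lambda>c. \<Sum>a=1..r. c a *\<^sub>R ?u a)"
      then obtain c d where "x = (\<Sum>a=1..r. c a *\<^sub>R ?u a)" "y = (\<Sum>a=1..r. d a *\<^sub>R ?u a)" by auto
      then show "x + y \<in> range (\<lambda>c. \<Sum>a=1..r. c a *\<^sub>R ?u a)"
        by (intro range_eqI[of _ _ "\<lambda>a. c a + d a"]) (simp add: scaleR_add_left sum.distrib)
    next
      fix k x assume "x \<in> range (\<lambda>c. \<Sum>a=1..r. c a *\<^sub>R ?u a)"
      then obtain c where "x = (\<Sum>a=1..r. c a *\<^sub>R ?u a)" by auto
      then show "k *\<^sub>R x \<in> range (\<lambda>c. \<Sum>a=1..r. c a *\<^sub>R ?u a)"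
        by (intro range_eqI[of _ _ "\<lambda>a. k * c a"]) (simp add: scaleR_sum_right)
    qed
  qed
  finally obtain c where c: "riesz f = (\<Sum>a=1..r. c a *\<^sub>R ?u a)" by auto
  have "f = (\<Sum>a=1..r. c a *\<^sub>R \<psi> a \<gamma>)"
    by (rule blinfun_eqI) (simp add: blinfun.sum_left blinfun.scaleR_left riesz[of f] riesz[of "\<psi> _ _"] c inner_sum_left)
  then show ?thesis by blast
qed

section \<open>Smoothness and derivatives along lines\<close>

lemma smooth_on_imp_differentiable:
  assumes "smooth_on S f" "open S" "x \<in> S"
  shows "f differentiable (at x)"
proof -
  have "Ck_on (Suc 0) S f" using assms(1) unfolding smooth_on_def by blast
  then have "f differentiable (at x within S)" using assms(3) by (simp add: differentiable_on_def)
  then show ?thesis by (simp only: at_within_open[OF assms(3,2)])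
qed

lemma smooth_on_frechet_derivative:
  assumes "smooth_on S f"
  shows "smooth_on S (\<lambda>x. frechet_derivative f (at x) h)"
  unfolding smooth_on_def
proof
  fix k
  have "Ck_on (Suc k) S f" using assms unfolding smooth_on_def by blast
  then show "Ck_on k S (\<lambda>x. frechet_derivative f (at x) h)" by simp
qed

text \<open>The bridge from the one-variable \<open>deriv\<close> in \<open>fderiv\<close>,
  \<open>partialL\<close> and \<open>D\<E>\<close> to the Frechet derivative, by the chain
  rule.\<close>

lemma has_real_derivative_along_line:
  fixes f :: "'a::real_normed_vector \<Rightarrow> real"
  assumes "f differentiable (at x)"
  shows "((\<lambda>s. f (x + s *\<^sub>R h)) has_real_derivative frechet_derivative f (at x) h) (at 0)"
proof -
  have f: "(f has_derivative frechet_derivative f (at x)) (at (x + 0 *\<^sub>R h))"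
    using assms by (simp add: frechet_derivative_works)
  have "((\<lambda>s. x + s *\<^sub>R h) has_derivative (\<lambda>s. s *\<^sub>R h)) (at 0)"
    by (auto intro!: derivative_eq_intros)
  from has_derivative_compose[OF this f]
  have "((\<lambda>s. f (x + s *\<^sub>R h)) has_derivative (\<lambda>s. frechet_derivative f (at x) (s *\<^sub>R h))) (at 0)"
    by simp
  moreover have "(\<lambda>s. frechet_derivative f (at x) (s *\<^sub>R h)) = (*) (frechet_derivative f (at x) h)"
    by (rule ext) (simp add: linear_scale[OF linear_frechet_derivative[OF assms]])
  ultimately show ?thesis
    by (simp add: has_field_derivative_def)
qed

text \<open>\<open>Blinfun\<close> yields the intended functional only for a bounded linear
  argument; differentiability guarantees that the directional derivatives form one.\<close>

lemma fderiv_apply: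
  fixes f :: "'a::real_normed_vector \<Rightarrow> real"
  assumes "f differentiable (at x)"
  shows "blinfun_apply (fderiv f x) h = frechet_derivative f (at x) h"
proof -
  have "(\<lambda>h. deriv (\<lambda>\<epsilon>. f (x + \<epsilon> *\<^sub>R h)) 0) = frechet_derivative f (at x)"
    using DERIV_imp_deriv[OF has_real_derivative_along_line[OF assms]] by blast
  moreover have "bounded_linear (frechet_derivative f (at x))"
    using assms by (simp add: frechet_derivative_works has_derivative_bounded_linear)
  ultimately show ?thesis by (simp add: fderiv_def bounded_linear_Blinfun_apply)
qed

lemma bounded_linear_blinfun_o_linear:
  fixes f :: "'a::euclidean_space \<Rightarrow> 'b::real_normed_vector"
  assumes "linear f"
  shows "bounded_linear (\<lambda>x. blinfun_apply \<gamma> (f x))"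
  using assms blinfun.bounded_linear_right bounded_linear_compose linear_conv_bounded_linear by blast

text \<open>In finite dimension such a map is a finite sum of its real components times fixed
  functionals. This will reduce the momentum curve to real-valued functions.\<close>

lemma blinfun_differentiable_componentwise:
  fixes F :: "'c::real_normed_vector \<Rightarrow> ('s::euclidean_space \<Rightarrow>\<^sub>L real)"
  assumes "\<And>b. b \<in> Basis \<Longrightarrow> (\<lambda>t. blinfun_apply (F t) b) differentiable net"
  shows "F differentiable net"
proof -
  have "F = (\<lambda>t. \<Sum>b\<in>Basis. blinfun_apply (F t) b *\<^sub>R blinfun_inner_left b)"
  proof (rule ext, rule blinfun_eqI)
    fix t x
    have "blinfun_apply (F t) x = blinfun_apply (F t) (\<Sum>b\<in>Basis. (x \<bullet> b) *\<^sub>R b)"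
      by (simp add: euclidean_representation)
    also have "\<dots> = blinfun_apply (\<Sum>b\<in>Basis. blinfun_apply (F t) b *\<^sub>R blinfun_inner_left b) x"
      by (simp add: blinfun.sum_right blinfun.sum_left blinfun.scaleR_right blinfun.scaleR_left
          inner_commute mult.commute)
    finally show "blinfun_apply (F t) x = blinfun_apply (\<Sum>b\<in>Basis. blinfun_apply (F t) b *\<^sub>R blinfun_inner_left b) x" .
  qed
  moreover have "(\<lambda>t. \<Sum>b\<in>Basis. blinfun_apply (F t) b *\<^sub>R (blinfun_inner_left b :: 's \<Rightarrow>\<^sub>L real)) differentiable net"
  proof (intro differentiable_sum ballI)
    fix b :: 's assume "b \<in> Basis"
    then obtain D where "((\<lambda>t. blinfun_apply (F t) b) has_derivative D) net"
      using assms by (auto simp: differentiable_def)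
    from has_derivative_scaleR_left[OF this]
    show "(\<lambda>t. blinfun_apply (F t) b *\<^sub>R (blinfun_inner_left b :: 's \<Rightarrow>\<^sub>L real)) differentiable net"
      by (rule differentiableI)
  qed auto
  ultimately show ?thesis by simp
qed

section \<open>The group multiplication in the identity chart\<close>

context lie_group
begin

abbreviation "U0 \<equiv> fst (id_chart G)"
abbreviation "x0 \<equiv> to_coord G \<one>"

lemma id_chart_mem: "(U0, to_coord G) \<in> atlas G"
  using id_chart(1) by (simp add: to_coord_def)

lemma id_chart_props:
  shows openin_U0: "openin (gtop G) U0"
    and open_coord: "open (to_coord G ` U0)"
    and homeo_coord: "homeomorphic_map (subtopology (gtop G) U0) (top_of_set (to_coord G ` U0)) (to_coord G)"
  using chart[OF id_chart_mem] by auto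

lemma U0_subset: "U0 \<subseteq> carrier G"
  using openin_U0 openin_subset topspace_gtop by fastforce

lemma inj_on_coord: "inj_on (to_coord G) U0"
  using homeo_coord U0_subset by (auto simp: homeomorphic_eq_everything_map topspace_gtop Int_absorb1)

lemma of_coord_to_coord: "g \<in> U0 \<Longrightarrow> of_coord G (to_coord G g) = g"
  using inj_on_coord by (simp add: of_coord_def to_coord_def)

lemma of_coord_x0: "of_coord G x0 = \<one>"
  using of_coord_to_coord id_chart(2) by blast

lemma of_coord_in: "x \<in> to_coord G ` U0 \<Longrightarrow> of_coord G x \<in> U0"
  using of_coord_to_coord by auto

lemma x0_in: "x0 \<in> to_coord G ` U0"
  using id_chart(2) by blast

text \<open>The chart is a homeomorphism, and its continuous inverse must agree with
  \<open>inv_into\<close> on the chart image.\<close>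

lemma continuous_of_coord:
  "continuous_map (top_of_set (to_coord G ` U0)) (gtop G) (of_coord G)"
proof -
  obtain g where g: "homeomorphic_maps (subtopology (gtop G) U0) (top_of_set (to_coord G ` U0)) (to_coord G) g"
    using homeo_coord homeomorphic_map_maps by blast
  have "g x = of_coord G x" if "x \<in> to_coord G ` U0" for x
    using that g of_coord_to_coord U0_subset by (auto simp: homeomorphic_maps_def topspace_gtop)
  moreover have "continuous_map (top_of_set (to_coord G ` U0)) (gtop G) g"
    using g by (auto simp: homeomorphic_maps_def continuous_map_in_subtopology)
  ultimately show ?thesis
    by (metis (mono_tags, lifting) continuous_map_eq topspace_euclidean_subtopology)
qed

abbreviation "mult_dom \<equiv> {(x, y). x \<in> to_coord G ` U0 \<and> y \<in> to_coord G ` U0 \<and> of_coord G x \<otimes> of_coord G y \<in> U0}"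
abbreviation "coord_mult \<equiv> \<lambda>(x, y). to_coord G (of_coord G x \<otimes> of_coord G y)"

text \<open>The domain is the preimage of the open set \<open>U0\<close> under a continuous map.
  Openness is what lets smoothness there give full derivatives at its points.\<close>

lemma open_mult_dom: "open mult_dom"
proof -
  let ?A = "to_coord G ` U0"
  have 1: "continuous_map (top_of_set (?A \<times> ?A)) (prod_topology (gtop G) (gtop G))
          (\<lambda>z. (of_coord G (fst z), of_coord G (snd z)))"
  proof (subst continuous_map_pairwise, intro conjI)
    have "continuous_map (top_of_set (?A \<times> ?A)) (top_of_set ?A) fst"
      by (auto simp: continuous_map_in_subtopology intro!: continuous_intros)
    from continuous_map_compose[OF this continuous_of_coord]
    show "continuous_map (top_of_set (?A \<times> ?A)) (gtop G) (fst \<circ> (\<lambda>z. (of_coord G (fst z), of_coord G (snd z))))"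
      by (simp add: o_def)
    have "continuous_map (top_of_set (?A \<times> ?A)) (top_of_set ?A) snd"
      by (auto simp: continuous_map_in_subtopology intro!: continuous_intros)
    from continuous_map_compose[OF this continuous_of_coord]
    show "continuous_map (top_of_set (?A \<times> ?A)) (gtop G) (snd \<circ> (\<lambda>z. (of_coord G (fst z), of_coord G (snd z))))"
      by (simp add: o_def)
  qed
  from continuous_map_compose[OF 1 mult_continuous]
  have "continuous_map (top_of_set (?A \<times> ?A)) (gtop G) (\<lambda>z. of_coord G (fst z) \<otimes> of_coord G (snd z))"
    by (simp add: o_def)
  from openin_continuous_map_preimage[OF this openin_U0]
  have "openin (top_of_set (?A \<times> ?A)) {z \<in> ?A \<times> ?A. of_coord G (fst z) \<otimes> of_coord G (snd z) \<in> U0}"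
    by simp
  also have "{z \<in> ?A \<times> ?A. of_coord G (fst z) \<otimes> of_coord G (snd z) \<in> U0} = mult_dom"
    by auto
  finally show ?thesis
    using openin_open_eq[OF open_Times[OF open_coord open_coord]] by blast
qed

lemma smooth_coord_mult: "smooth_on mult_dom coord_mult"
  using mult_smooth[OF id_chart_mem id_chart_mem id_chart_mem]
  by (simp add: of_coord_def to_coord_def)

lemma x_x0_in_mult_dom: "x \<in> to_coord G ` U0 \<Longrightarrow> (x, x0) \<in> mult_dom"
  using of_coord_in[of x] U0_subset x0_in by (auto simp: of_coord_x0 subset_iff)

text \<open>The field is a partial derivative, in the second factor, of the jointly smooth
  multiplication. In this form both its linearity in \<open>\<xi>\<close> and its regularity in
  \<open>x\<close> become visible.\<close>

lemma left_inv_field_eq: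
  assumes "x \<in> to_coord G ` U0"
  shows "left_inv_field G \<xi> x = frechet_derivative coord_mult (at (x, x0)) (0, \<xi>)"
proof -
  have "coord_mult differentiable (at (x, x0))"
    using smooth_on_imp_differentiable[OF smooth_coord_mult open_mult_dom x_x0_in_mult_dom[OF assms]] .
  then have f: "(coord_mult has_derivative frechet_derivative coord_mult (at (x, x0))) (at (x, x0))"
    by (simp add: frechet_derivative_works)
  have "((\<lambda>y. (x, y)) has_derivative (\<lambda>h. (0, h))) (at x0)"
    by (auto intro!: derivative_eq_intros)
  from has_derivative_compose[OF this f]
  have "((\<lambda>y. to_coord G (of_coord G x \<otimes> of_coord G y)) has_derivative
      (\<lambda>h. frechet_derivative coord_mult (at (x, x0)) (0, h))) (at x0)"
    by simp
  from frechet_derivative_at[OF this] show ?thesis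
    by (simp add: left_inv_field_def fun_eq_iff)
qed

text \<open>A directional derivative of a smooth map is again smooth. The formula for the field
  holds only on the chart image, but this is a neighbourhood of \<open>x0\<close>.\<close>

lemma left_inv_field_differentiable: "left_inv_field G \<xi> differentiable (at x0)"
proof -
  let ?D = "\<lambda>z. frechet_derivative coord_mult (at z) (0, \<xi>)"
  have "?D differentiable (at (x0, x0))"
    using smooth_on_imp_differentiable[OF smooth_on_frechet_derivative[OF smooth_coord_mult]
        open_mult_dom x_x0_in_mult_dom[OF x0_in]] .
  then obtain D' where D': "(?D has_derivative D') (at (x0, x0))" by (auto simp: differentiable_def)
  have "((\<lambda>x. (x, x0)) has_derivative (\<lambda>h. (h, 0))) (at x0)"
    by (auto intro!: derivative_eq_intros)
  from has_derivative_compose[OF this D']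
  have "((\<lambda>x. ?D (x, x0)) has_derivative (\<lambda>h. D' (h, 0))) (at x0)" .
  from has_derivative_transform_within_open[OF this open_coord x0_in]
  show ?thesis using left_inv_field_eq unfolding differentiable_def by metis
qed

lemma left_inv_field_linear:
  assumes "x \<in> to_coord G ` U0"
  shows "linear (\<lambda>\<xi>. left_inv_field G \<xi> x)"
proof -
  have "linear (frechet_derivative coord_mult (at (x, x0)))"
    using smooth_on_imp_differentiable[OF smooth_coord_mult open_mult_dom x_x0_in_mult_dom[OF assms]]
    by (rule linear_frechet_derivative)
  from linear_add[OF this, of "(0, _)" "(0, _)"] linear_scale[OF this, of _ "(0, _)"]
  show ?thesis by (intro linearI) (simp_all add: left_inv_field_eq[OF assms])
qed

text \<open>The fields depend linearly on \<open>\<eta>\<close> at every point of a neighbourhood of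
  \<open>x0\<close>, so their derivatives at \<open>x0\<close> do too.\<close>

lemma linear_derivative_left_inv_field:
  "linear (\<lambda>\<eta>. frechet_derivative (left_inv_field G \<eta>) (at x0) \<xi>)"
proof (rule linearI)
  have D: "(left_inv_field G \<eta> has_derivative frechet_derivative (left_inv_field G \<eta>) (at x0)) (at x0)" for \<eta>
    using left_inv_field_differentiable frechet_derivative_works by blast
  fix \<eta> \<zeta> and c :: real
  have "(left_inv_field G (\<eta> + \<zeta>) has_derivative
      (\<lambda>h. frechet_derivative (left_inv_field G \<eta>) (at x0) h + frechet_derivative (left_inv_field G \<zeta>) (at x0) h)) (at x0)"
    by (rule has_derivative_transform_within_open[OF has_derivative_add[OF D D] open_coord x0_in])
       (simp add: linear_add[OF left_inv_field_linear])
  from frechet_derivative_at[OF this]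
  show "frechet_derivative (left_inv_field G (\<eta> + \<zeta>)) (at x0) \<xi> =
      frechet_derivative (left_inv_field G \<eta>) (at x0) \<xi> + frechet_derivative (left_inv_field G \<zeta>) (at x0) \<xi>"
    by (simp add: fun_eq_iff)
  have "(left_inv_field G (c *\<^sub>R \<eta>) has_derivative
      (\<lambda>h. c *\<^sub>R frechet_derivative (left_inv_field G \<eta>) (at x0) h)) (at x0)"
    by (rule has_derivative_transform_within_open[OF has_derivative_scaleR_right[OF D] open_coord x0_in])
       (simp add: linear_scale[OF left_inv_field_linear])
  from frechet_derivative_at[OF this]
  show "frechet_derivative (left_inv_field G (c *\<^sub>R \<eta>)) (at x0) \<xi> =
      c *\<^sub>R frechet_derivative (left_inv_field G \<eta>) (at x0) \<xi>"
    by (simp add: fun_eq_iff)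
qed

text \<open>One term is linear because the field depends linearly on its generator, the other
  because a derivative is linear in its direction. Antisymmetry will handle the first slot.\<close>

lemma linear_lie_bracket: "linear (lie_bracket G \<xi>)"
  unfolding lie_bracket_def
  by (intro linear_compose_sub linear_derivative_left_inv_field
      linear_frechet_derivative left_inv_field_differentiable)

lemma lie_bracket_antisym: "lie_bracket G \<xi> \<eta> = - lie_bracket G \<eta> \<xi>"
  by (simp add: lie_bracket_def)

section \<open>The induced action on X and its bilinearity\<close>

lemma lie_exp_in_carrier:
  assumes "is_lie_exp G ex"
  shows "ex (t *\<^sub>R \<xi>) \<in> carrier G"
proof -
  have "continuous_map euclideanreal (gtop G) (\<lambda>t. ex (t *\<^sub>R \<xi>))"
    using assms by (simp add: is_lie_exp_def)
  from continuous_map_image_subset_topspace[OF this] show ?thesis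
    by (simp add: topspace_gtop image_subset_iff)
qed

text \<open>By continuity the one-parameter subgroup stays in \<open>U0\<close> for small
  \<open>t\<close>. There the orbit is the smooth map
  \<open>\<lambda>y. \<rho> (of_coord G y) x\<close> composed with a coordinate curve of velocity
  \<open>\<xi>\<close> at 0.\<close>

lemma orbit_has_vector_derivative:
  assumes ex: "is_lie_exp G ex" and \<rho>: "lie_group_representation G \<rho>"
  shows "((\<lambda>t. \<rho> (ex (t *\<^sub>R \<xi>)) x) has_vector_derivative
     frechet_derivative (\<lambda>y. \<rho> (of_coord G y) x) (at x0) \<xi>) (at 0)"
proof -
  have cont: "continuous_map euclideanreal (gtop G) (\<lambda>t. ex (t *\<^sub>R \<xi>))"
    and hom: "\<And>s t. ex ((s + t) *\<^sub>R \<xi>) = ex (s *\<^sub>R \<xi>) \<otimes> ex (t *\<^sub>R \<xi>)"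
    and vd: "((\<lambda>t. to_coord G (ex (t *\<^sub>R \<xi>))) has_vector_derivative \<xi>) (at 0)"
    using ex by (auto simp: is_lie_exp_def)
  \<comment> \<open>The homomorphism law at 0 makes this element equal to its own square, and in a
    group only the identity is.\<close>
  from lie_exp_in_carrier[OF ex, of 0] hom[of 0 0] have ex0: "ex (0 *\<^sub>R \<xi>) = \<one>"
    by simp
  have openT: "open {t. ex (t *\<^sub>R \<xi>) \<in> U0}"
    using openin_continuous_map_preimage[OF cont openin_U0] by simp
  have "smooth_on (to_coord G ` U0) (\<lambda>y. \<rho> (of_coord G y) x)"
    using \<rho> id_chart_mem unfolding lie_group_representation_def of_coord_def to_coord_def by fastforce
  then have "(\<lambda>y. \<rho> (of_coord G y) x) differentiable (at x0)"
    using smooth_on_imp_differentiable open_coord x0_in by blast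
  then have f: "((\<lambda>y. \<rho> (of_coord G y) x) has_derivative frechet_derivative (\<lambda>y. \<rho> (of_coord G y) x) (at x0))
     (at (to_coord G (ex (0 *\<^sub>R \<xi>))))"
    by (simp only: ex0 frechet_derivative_works)
  then have lin: "linear (frechet_derivative (\<lambda>y. \<rho> (of_coord G y) x) (at x0))"
    using has_derivative_linear by blast
  have "((\<lambda>t. \<rho> (of_coord G (to_coord G (ex (t *\<^sub>R \<xi>)))) x) has_vector_derivative
     frechet_derivative (\<lambda>y. \<rho> (of_coord G y) x) (at x0) \<xi>) (at 0)"
    using has_derivative_compose[OF vd[unfolded has_vector_derivative_def] f]
    by (simp add: has_vector_derivative_def linear_scale[OF lin])
  then show ?thesis
    by (rule has_vector_derivative_transform_within_open[OF _ openT])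
       (auto simp: ex0[simplified] id_chart(2) of_coord_to_coord)
qed

lemma induced_action_eq:
  assumes "is_lie_exp G ex" "lie_group_representation G \<rho>"
  shows "induced_action ex \<rho> \<xi> x = frechet_derivative (\<lambda>y. \<rho> (of_coord G y) x) (at x0) \<xi>"
  unfolding induced_action_def by (rule vector_derivative_at[OF orbit_has_vector_derivative[OF assms]])

lemma linear_induced_action_left:
  assumes "is_lie_exp G ex" and \<rho>: "lie_group_representation G \<rho>"
  shows "linear (\<lambda>\<xi>. induced_action ex \<rho> \<xi> x)"
proof -
  have "smooth_on (to_coord G ` U0) (\<lambda>y. \<rho> (of_coord G y) x)"
    using \<rho> id_chart_mem unfolding lie_group_representation_def of_coord_def to_coord_def by fastforce
  then show ?thesis
    unfolding induced_action_eq[OF assms]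
    using smooth_on_imp_differentiable open_coord x0_in linear_frechet_derivative by blast
qed

text \<open>Linearity in \<open>x\<close> comes from that of each \<open>\<rho> g\<close> and
  survives differentiation in \<open>t\<close>; linearity in \<open>\<xi>\<close> instead came from
  the Frechet derivative.\<close>

lemma linear_induced_action_right:
  assumes ex: "is_lie_exp G ex" and \<rho>: "lie_group_representation G \<rho>"
  shows "linear (induced_action ex \<rho> \<xi>)"
proof (rule linearI)
  have V: "((\<lambda>t. \<rho> (ex (t *\<^sub>R \<xi>)) x) has_vector_derivative induced_action ex \<rho> \<xi> x) (at 0)" for x
    using orbit_has_vector_derivative[OF assms] by (simp add: induced_action_eq[OF assms])
  have lin: "linear (\<rho> (ex (t *\<^sub>R \<xi>)))" for t
    using \<rho> lie_exp_in_carrier[OF ex] by (simp add: lie_group_representation_def)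
  fix x y and c :: real
  show "induced_action ex \<rho> \<xi> (x + y) = induced_action ex \<rho> \<xi> x + induced_action ex \<rho> \<xi> y"
    unfolding induced_action_def[of ex \<rho> \<xi> "x + y"]
    using vector_derivative_at[OF has_vector_derivative_add[OF V V]] by (simp add: linear_add[OF lin])
  have "((\<lambda>t. c *\<^sub>R \<rho> (ex (t *\<^sub>R \<xi>)) x) has_vector_derivative c *\<^sub>R induced_action ex \<rho> \<xi> x) (at 0)"
    using bounded_linear.has_vector_derivative[OF bounded_linear_scaleR_right V] .
  from vector_derivative_at[OF this]
  show "induced_action ex \<rho> \<xi> (c *\<^sub>R x) = c *\<^sub>R induced_action ex \<rho> \<xi> x"
    unfolding induced_action_def[of ex \<rho> \<xi> "c *\<^sub>R x"] by (simp add: linear_scale[OF lin])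
qed

end


theorem theorem12:
  fixes G :: "('g, 's::euclidean_space) lie_group_data"
    and ex :: "'s \<Rightarrow> 'g"
    and \<rho> :: "'g \<Rightarrow> 'x::euclidean_space \<Rightarrow> 'x"
    and L :: "'s \<Rightarrow> ('x \<Rightarrow>\<^sub>L real) \<Rightarrow> real"
    and \<psi> :: "nat \<Rightarrow> ('x \<Rightarrow>\<^sub>L real) \<Rightarrow> ('s \<Rightarrow>\<^sub>L real)"
    and \<E> :: "nat \<Rightarrow> ('x \<Rightarrow>\<^sub>L real) \<Rightarrow> 's"
    and E :: "nat \<Rightarrow> 's"
    and e :: "nat \<Rightarrow> 'x"
    and n m r :: nat
    and \<kappa> :: "nat \<Rightarrow> nat \<Rightarrow> nat \<Rightarrow> real"
    and I :: "real set"
    and \<xi> :: "real \<Rightarrow> 's"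
    and \<Gamma> :: "real \<Rightarrow> ('x \<Rightarrow>\<^sub>L real)"
    and v :: "real \<Rightarrow> nat \<Rightarrow> real"
  defines "br \<equiv> lie_bracket G"
    and "act \<equiv> induced_action ex \<rho>"
    and "es \<equiv> dual_basis m e"
    and "dL_d\<xi> \<equiv> \<lambda>\<eta> \<gamma>. fderiv (\<lambda>\<eta>'. L \<eta>' \<gamma>) \<eta>"
    and "dL_d\<Gamma> \<equiv> \<lambda>\<eta> \<gamma>. of_bidual (fderiv (\<lambda>\<gamma>'. L \<eta> \<gamma>') \<gamma>)"
  defines "\<xi>c \<equiv> \<lambda>w \<gamma>. \<Sum>\<alpha> = 1..n - r. w \<alpha> *\<^sub>R \<E> \<alpha> \<gamma>"
  defines "p \<equiv> \<lambda>i w \<gamma>. blinfun_apply (dL_d\<xi> (\<xi>c w \<gamma>) \<gamma>) (\<E> i \<gamma>)"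
    and "partialL \<equiv> \<lambda>j w \<gamma>. deriv (\<lambda>s. L (\<xi>c w \<gamma>) (\<gamma> + s *\<^sub>R es j)) 0"
    and "\<E>comp \<equiv> \<lambda>l j \<gamma>. coord n E (\<E> j \<gamma>) l"
    and "\<E>inv \<equiv> \<lambda>j i \<gamma>. coord n (\<lambda>k. \<E> k \<gamma>) (E i) j"
    and "\<C> \<equiv> \<lambda>k i j \<gamma>. coord n (\<lambda>l. \<E> l \<gamma>) (br (\<E> i \<gamma>) (\<E> j \<gamma>)) k"
    and "\<K> \<equiv> \<lambda>k i j \<gamma>. blinfun_apply (K_map act (e j) (es k)) (\<E> i \<gamma>)"
  defines "vk \<equiv> \<lambda>k i \<beta> \<gamma>. \<Sum>j = 1..n. \<kappa> k i j * \<E>comp j \<beta> \<gamma>"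
    and "D\<E> \<equiv> \<lambda>j l \<alpha> \<gamma>. deriv (\<lambda>s. \<E>comp l \<alpha> (\<gamma> + s *\<^sub>R es j)) 0"
  defines "\<F> \<equiv> \<lambda>i \<alpha> \<beta> \<gamma>. \<Sum>j = 1..m. \<Sum>l = 1..n. \<Sum>k = 1..m.
        D\<E> j l \<alpha> \<gamma> * \<E>inv i l \<gamma> * vk k j \<beta> \<gamma> * coord m es \<gamma> k"
  defines "\<B> \<equiv> \<lambda>i \<alpha> \<beta> \<gamma>. \<C> i \<alpha> \<beta> \<gamma> + \<F> i \<alpha> \<beta> \<gamma>"
  assumes "lie_group G" "is_lie_exp G ex" "lie_group_representation G \<rho>"
    and "n = DIM('s)" "m = DIM('x)" "r \<le> n"
    and "smooth_on UNIV (\<lambda>(\<eta>, \<gamma>). L \<eta> \<gamma>)"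
    and "\<And>a. a \<in> {1..r} \<Longrightarrow> smooth_on UNIV (\<psi> a)"
    and "\<And>i. i \<in> {1..n} \<Longrightarrow> smooth_on UNIV (\<E> i)"
    and "\<And>\<gamma>. indexed_basis n (\<lambda>i. \<E> i \<gamma>)"
    and "\<And>\<gamma>. constraint_space \<psi> r \<gamma> = span ((\<lambda>\<alpha>. \<E> \<alpha> \<gamma>) ` {1..n - r})"
    and "indexed_basis n E"
    and "indexed_basis m e"
    and "\<And>\<eta> \<gamma>. dual_action act \<eta> \<gamma> =
          (\<Sum>i = 1..m. \<Sum>j = 1..n. \<Sum>k = 1..m.
             (\<kappa> k i j * coord n E \<eta> j * coord m es \<gamma> k) *\<^sub>R es i)"
    and "is_interval I" "interior I \<noteq> {}"
    and "\<xi> differentiable_on I" "\<Gamma> differentiable_on I"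
    and "\<And>t. t \<in> I \<Longrightarrow> \<xi> t = \<xi>c (v t) (\<Gamma> t)"
  shows
    "(\<exists>lam :: nat \<Rightarrow> real \<Rightarrow> real. \<forall>t \<in> I.
        ((\<lambda>t. dL_d\<xi> (\<xi> t) (\<Gamma> t)) has_vector_derivative
           (ad_star br (\<xi> t) (dL_d\<xi> (\<xi> t) (\<Gamma> t)) + K_map act (dL_d\<Gamma> (\<xi> t) (\<Gamma> t)) (\<Gamma> t) +
            (\<Sum>a = 1..r. lam a t *\<^sub>R \<psi> a (\<Gamma> t)))) (at t within I) \<and>
        (\<Gamma> has_vector_derivative - dual_action act (\<xi> t) (\<Gamma> t)) (at t within I) \<and>
        \<xi> t \<in> constraint_space \<psi> r (\<Gamma> t))
     \<longleftrightarrow>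
     (\<forall>t \<in> I.
        (\<forall>\<alpha> \<in> {1..n - r}.
           ((\<lambda>t. p \<alpha> (v t) (\<Gamma> t)) has_real_derivative
              (- (\<Sum>i = 1..n. \<Sum>\<beta> = 1..n - r. \<B> i \<alpha> \<beta> (\<Gamma> t) * p i (v t) (\<Gamma> t) * v t \<beta>) +
               (\<Sum>j = 1..m. \<Sum>k = 1..m.
                  \<K> k \<alpha> j (\<Gamma> t) * partialL j (v t) (\<Gamma> t) * coord m es (\<Gamma> t) k)))
             (at t within I)) \<and>
        (\<forall>i \<in> {1..m}.
           ((\<lambda>t. coord m es (\<Gamma> t) i) has_real_derivative
              - (\<Sum>\<beta> = 1..n - r. \<Sum>k = 1..m. vk k i \<beta> (\<Gamma> t) * v t \<beta> * coord m es (\<Gamma> t) k))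
             (at t within I)))"
proof -
  interpret lie_group G by (rule assms(17))
  note ex = assms(18) and rep = assms(19)
  note smL = assms(23) and smE = assms(25)
    and basis\<E> = assms(26) and cs = assms(27) and basisE = assms(28) and basise = assms(29)
    and kappa = assms(30) and \<xi>diff = assms(33) and \<Gamma>diff = assms(34) and \<xi>_eq = assms(35)
  note basises = indexed_basis_dual_basis[OF basise, folded es_def]
  let ?L = "\<lambda>(\<eta>, \<gamma>). L \<eta> \<gamma>"

  \<comment> \<open>Evaluation of the operators in the equations of motion\<close>
  have lin_br: "linear (br \<eta>)" for \<eta>
    unfolding br_def by (rule linear_lie_bracket)
  have lin_act_left: "linear (\<lambda>\<eta>. act \<eta> x)" for x
    unfolding act_def by (rule linear_induced_action_left[OF ex rep])
  have lin_act_right: "linear (act \<eta>)" for \<eta>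
    unfolding act_def by (rule linear_induced_action_right[OF ex rep])
  \<comment> \<open>The linearity facts above are needed to evaluate the three
    \<open>Blinfun\<close> definitions.\<close>
  have dual_action_apply: "blinfun_apply (dual_action act \<eta> \<gamma>) x = - blinfun_apply \<gamma> (act \<eta> x)" for \<eta> \<gamma> x
    unfolding dual_action_def
    by (simp add: bounded_linear_Blinfun_apply[OF bounded_linear_minus] bounded_linear_blinfun_o_linear lin_act_right)
  have K_map_apply: "blinfun_apply (K_map act x \<gamma>) \<eta> = blinfun_apply \<gamma> (act \<eta> x)" for \<eta> \<gamma> x
    unfolding K_map_def
    by (simp add: bounded_linear_Blinfun_apply bounded_linear_blinfun_o_linear lin_act_left)
  have ad_star_apply: "blinfun_apply (ad_star br \<zeta> \<mu>) \<eta> = blinfun_apply \<mu> (br \<zeta> \<eta>)" for \<eta> \<mu> \<zeta>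
    unfolding ad_star_def
    by (simp add: bounded_linear_Blinfun_apply bounded_linear_blinfun_o_linear lin_br)

  \<comment> \<open>Derivatives of the Lagrangian and of the moving basis\<close>
  have L_has_derivative: "(?L has_derivative frechet_derivative ?L (at z)) (at z)" for z
    using smooth_on_imp_differentiable[OF smL open_UNIV UNIV_I] by (simp add: frechet_derivative_works)
  \<comment> \<open>Writing the momentum through the derivative of the joint function keeps its
    smooth dependence on both arguments, needed when differentiating along the curve.\<close>
  have dL_d\<xi>_apply: "blinfun_apply (dL_d\<xi> \<eta> \<gamma>) h = frechet_derivative ?L (at (\<eta>, \<gamma>)) (h, 0)" for \<eta> \<gamma> h
  proof -
    have "((\<lambda>\<eta>'. (\<eta>', \<gamma>)) has_derivative (\<lambda>h. (h, 0))) (at \<eta>)"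
      by (auto intro!: derivative_eq_intros)
    from has_derivative_compose[OF this L_has_derivative]
    have D: "((\<lambda>\<eta>'. L \<eta>' \<gamma>) has_derivative (\<lambda>h. frechet_derivative ?L (at (\<eta>, \<gamma>)) (h, 0))) (at \<eta>)"
      by simp
    from fderiv_apply[OF differentiableI[OF D]] frechet_derivative_at[OF D]
    show ?thesis by (simp add: dL_d\<xi>_def fun_eq_iff)
  qed
  have L_differentiable_right: "L \<eta> differentiable (at \<gamma>)" for \<eta> \<gamma>
  proof -
    have "((\<lambda>\<gamma>'. (\<eta>, \<gamma>')) has_derivative (\<lambda>h. (0, h))) (at \<gamma>)"
      by (auto intro!: derivative_eq_intros)
    from has_derivative_compose[OF this L_has_derivative]
    show ?thesis by (auto intro: differentiableI)
  qed
  have dL_d\<Gamma>_eq: "dL_d\<Gamma> (\<xi>c w \<gamma>) \<gamma> = (\<Sum>j=1..m. partialL j w \<gamma> *\<^sub>R e j)" for w \<gamma>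
  proof -
    have "blinfun_apply (fderiv (L (\<xi>c w \<gamma>)) \<gamma>) (es j) = partialL j w \<gamma>" for j
      using DERIV_imp_deriv[OF has_real_derivative_along_line[OF L_differentiable_right]]
      by (simp add: fderiv_apply[OF L_differentiable_right] partialL_def)
    then show ?thesis
      unfolding dL_d\<Gamma>_def es_def by (simp add: of_bidual_eq[OF basise])
  qed

  have \<E>_differentiable: "\<E> \<alpha> differentiable (at \<gamma>)" if "\<alpha> \<in> {1..n}" for \<alpha> \<gamma>
    using smooth_on_imp_differentiable[OF smE[OF that] open_UNIV UNIV_I] .
  \<comment> \<open>The numbers \<open>D\<E> j l \<alpha> \<gamma>\<close> are coordinates in the
    fixed basis \<open>E\<close>, since taking a coordinate is linear and commutes with
    differentiation.\<close>
  have \<E>_derivative: "frechet_derivative (\<E> \<alpha>) (at \<gamma>) (es j) = (\<Sum>l=1..n. D\<E> j l \<alpha> \<gamma> *\<^sub>R E l)"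
    if "\<alpha> \<in> {1..n}" for \<alpha> \<gamma> j
  proof -
    have D: "D\<E> j l \<alpha> \<gamma> = coord n E (frechet_derivative (\<E> \<alpha>) (at \<gamma>) (es j)) l" for l
    proof -
      have lin: "bounded_linear (\<lambda>x. coord n E x l)"
        using linear_coord[OF basisE] by (simp add: linear_conv_bounded_linear)
      have "((\<lambda>\<gamma>'. \<E>comp l \<alpha> \<gamma>') has_derivative (\<lambda>h. coord n E (frechet_derivative (\<E> \<alpha>) (at \<gamma>) h) l)) (at \<gamma>)"
        unfolding \<E>comp_def
        using bounded_linear.has_derivative[OF lin] \<E>_differentiable[OF that] frechet_derivative_works by blast
      note this = differentiableI[OF this] frechet_derivative_at[OF this]
      from DERIV_imp_deriv[OF has_real_derivative_along_line[OF this(1)]] this(2)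
      show ?thesis by (simp add: D\<E>_def fun_eq_iff)
    qed
    show ?thesis by (simp add: D indexed_basis_representation[OF basisE])
  qed

  \<comment> \<open>Coordinate expansions of the individual terms\<close>
  have dual_action_coord: "blinfun_apply (dual_action act (\<xi>c w \<gamma>) \<gamma>) (e i) =
      (\<Sum>\<beta>=1..n - r. \<Sum>k=1..m. vk k i \<beta> \<gamma> * w \<beta> * coord m es \<gamma> k)" if i: "i \<in> {1..m}" for i w \<gamma>
  proof -
    have c: "coord n E (\<xi>c w \<gamma>) j = (\<Sum>\<beta>=1..n - r. w \<beta> * \<E>comp j \<beta> \<gamma>)" for j
      by (simp add: \<xi>c_def \<E>comp_def coord_sum_scaleR[OF basisE])
    have "blinfun_apply (dual_action act (\<xi>c w \<gamma>) \<gamma>) (e i) =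
      (\<Sum>i'=1..m. blinfun_apply (es i') (e i) * (\<Sum>j=1..n. \<Sum>k=1..m. \<kappa> k i' j * coord n E (\<xi>c w \<gamma>) j * coord m es \<gamma> k))"
      unfolding kappa by (simp add: blinfun.sum_left blinfun.scaleR_left sum_distrib_left mult_ac)
    also have "\<dots> = (\<Sum>i'=1..m. if i' = i then (\<Sum>j=1..n. \<Sum>k=1..m. \<kappa> k i' j * coord n E (\<xi>c w \<gamma>) j * coord m es \<gamma> k) else 0)"
      using i by (intro sum.cong) (simp_all add: es_def dual_basis_apply[OF basise] coord_basis[OF basise])
    also have "\<dots> = (\<Sum>j=1..n. \<Sum>k=1..m. \<kappa> k i j * coord n E (\<xi>c w \<gamma>) j * coord m es \<gamma> k)"
      using i by simp
    also have "\<dots> = (\<Sum>j=1..n. \<Sum>k=1..m. \<Sum>\<beta>=1..n - r. \<kappa> k i j * \<E>comp j \<beta> \<gamma> * w \<beta> * coord m es \<gamma> k)"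
      by (simp add: c sum_distrib_left sum_distrib_right mult_ac)
    \<comment> \<open>The sum over \<open>j\<close> is moved innermost, where it contracts
      \<open>\<kappa>\<close> with \<open>\<E>comp\<close> to \<open>vk\<close>.\<close>
    also have "\<dots> = (\<Sum>k=1..m. \<Sum>\<beta>=1..n - r. \<Sum>j=1..n. \<kappa> k i j * \<E>comp j \<beta> \<gamma> * w \<beta> * coord m es \<gamma> k)"
      by (rule trans[OF sum.swap]) (intro sum.cong refl sum.swap)
    also have "\<dots> = (\<Sum>\<beta>=1..n - r. \<Sum>k=1..m. \<Sum>j=1..n. \<kappa> k i j * \<E>comp j \<beta> \<gamma> * w \<beta> * coord m es \<gamma> k)"
      by (rule sum.swap)
    also have "\<dots> = (\<Sum>\<beta>=1..n - r. \<Sum>k=1..m. vk k i \<beta> \<gamma> * w \<beta> * coord m es \<gamma> k)"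
      by (simp add: vk_def sum_distrib_right)
    finally show ?thesis .
  qed
  have coord_es: "coord m es \<gamma> i = blinfun_apply \<gamma> (e i)" if "i \<in> {1..m}" for \<gamma> i
    unfolding es_def by (rule coord_dual_basis[OF basise that])

  \<comment> \<open>Antisymmetry moves the velocity into the second slot; this matches the index
    order of \<open>\<C>\<close> and produces the minus sign in front of
    \<open>\<B>\<close>.\<close>
  have bracket_term: "blinfun_apply \<mu> (br (\<xi>c w \<gamma>) (\<E> \<alpha> \<gamma>)) =
      - (\<Sum>i=1..n. \<Sum>\<beta>=1..n - r. \<C> i \<alpha> \<beta> \<gamma> * blinfun_apply \<mu> (\<E> i \<gamma>) * w \<beta>)" for \<mu> w \<gamma> \<alpha>
  proof -
    have "br (\<xi>c w \<gamma>) (\<E> \<alpha> \<gamma>) = - br (\<E> \<alpha> \<gamma>) (\<xi>c w \<gamma>)"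
      unfolding br_def by (rule lie_bracket_antisym)
    also have "br (\<E> \<alpha> \<gamma>) (\<xi>c w \<gamma>) = (\<Sum>\<beta>=1..n - r. w \<beta> *\<^sub>R br (\<E> \<alpha> \<gamma>) (\<E> \<beta> \<gamma>))"
      by (simp add: \<xi>c_def linear_sum[OF lin_br] linear_scale[OF lin_br])
    also have "\<dots> = (\<Sum>\<beta>=1..n - r. w \<beta> *\<^sub>R (\<Sum>i=1..n. \<C> i \<alpha> \<beta> \<gamma> *\<^sub>R \<E> i \<gamma>))"
      by (simp add: \<C>_def indexed_basis_representation[OF basis\<E>])
    finally have "blinfun_apply \<mu> (br (\<xi>c w \<gamma>) (\<E> \<alpha> \<gamma>)) =
        - (\<Sum>\<beta>=1..n - r. \<Sum>i=1..n. \<C> i \<alpha> \<beta> \<gamma> * blinfun_apply \<mu> (\<E> i \<gamma>) * w \<beta>)"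
      by (simp add: blinfun.minus_right blinfun.sum_right blinfun.scaleR_right sum_distrib_left mult_ac)
    then show ?thesis by (subst sum.swap)
  qed

  have K_term: "blinfun_apply (K_map act (dL_d\<Gamma> (\<xi>c w \<gamma>) \<gamma>) \<gamma>) (\<E> \<alpha> \<gamma>) =
      (\<Sum>j=1..m. \<Sum>k=1..m. \<K> k \<alpha> j \<gamma> * partialL j w \<gamma> * coord m es \<gamma> k)" for w \<gamma> \<alpha>
  proof -
    have g: "blinfun_apply \<gamma> x = (\<Sum>k=1..m. coord m es \<gamma> k * blinfun_apply (es k) x)" for x
      by (subst indexed_basis_representation[OF basises, of \<gamma>, symmetric])
         (simp only: blinfun.sum_left blinfun.scaleR_left real_scaleR_def)
    have "blinfun_apply (K_map act (dL_d\<Gamma> (\<xi>c w \<gamma>) \<gamma>) \<gamma>) (\<E> \<alpha> \<gamma>) =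
        (\<Sum>j=1..m. partialL j w \<gamma> * blinfun_apply \<gamma> (act (\<E> \<alpha> \<gamma>) (e j)))"
      unfolding K_map_apply dL_d\<Gamma>_eq
      by (simp add: linear_sum[OF lin_act_right] linear_scale[OF lin_act_right] blinfun.sum_right blinfun.scaleR_right)
    also have "\<dots> = (\<Sum>j=1..m. \<Sum>k=1..m. \<K> k \<alpha> j \<gamma> * partialL j w \<gamma> * coord m es \<gamma> k)"
      by (simp add: g[of "act _ _"] \<K>_def K_map_apply sum_distrib_left mult_ac)
    finally show ?thesis .
  qed

  \<comment> \<open>The moving basis is differentiated along \<xi>\<Gamma>. Its derivative is known
    in the fixed basis; converting back to the moving one brings in \<open>\<E>inv\<close> and gives
    exactly \<open>\<F>\<close>.\<close>
  have frame_term: "blinfun_apply \<mu> (frechet_derivative (\<E> \<alpha>) (at \<gamma>) (dual_action act (\<xi>c w \<gamma>) \<gamma>)) =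
      (\<Sum>i=1..n. \<Sum>\<beta>=1..n - r. \<F> i \<alpha> \<beta> \<gamma> * blinfun_apply \<mu> (\<E> i \<gamma>) * w \<beta>)"
    if \<alpha>: "\<alpha> \<in> {1..n}" for \<mu> w \<gamma> \<alpha>
  proof -
    let ?d = "\<lambda>j. \<Sum>\<beta>=1..n - r. \<Sum>k=1..m. vk k j \<beta> \<gamma> * w \<beta> * coord m es \<gamma> k"
    let ?q = "\<lambda>i. blinfun_apply \<mu> (\<E> i \<gamma>)"
    let ?T = "\<lambda>i \<beta> j l k. D\<E> j l \<alpha> \<gamma> * \<E>inv i l \<gamma> * vk k j \<beta> \<gamma> * coord m es \<gamma> k * ?q i * w \<beta>"
    have lin: "linear (frechet_derivative (\<E> \<alpha>) (at \<gamma>))"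
      using \<E>_differentiable[OF \<alpha>] by (rule linear_frechet_derivative)
    have E: "blinfun_apply \<mu> (E l) = (\<Sum>i=1..n. \<E>inv i l \<gamma> * ?q i)" for l
      by (subst indexed_basis_representation[OF basis\<E>, of \<gamma> "E l", symmetric])
         (simp only: \<E>inv_def blinfun.sum_right blinfun.scaleR_right real_scaleR_def)
    have "dual_action act (\<xi>c w \<gamma>) \<gamma> = (\<Sum>j=1..m. ?d j *\<^sub>R es j)"
      by (subst blinfun_eq_sum_dual_basis[OF basise]) (simp add: dual_action_coord es_def)
    then have "blinfun_apply \<mu> (frechet_derivative (\<E> \<alpha>) (at \<gamma>) (dual_action act (\<xi>c w \<gamma>) \<gamma>)) =
        (\<Sum>j=1..m. ?d j * (\<Sum>l=1..n. D\<E> j l \<alpha> \<gamma> * (\<Sum>i=1..n. \<E>inv i l \<gamma> * ?q i)))"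
      by (simp add: linear_sum[OF lin] linear_scale[OF lin] \<E>_derivative[OF \<alpha>] blinfun.sum_right
          blinfun.scaleR_right E)
    also have "\<dots> = (\<Sum>j=1..m. \<Sum>l=1..n. \<Sum>\<beta>=1..n - r. \<Sum>i=1..n. \<Sum>k=1..m. ?T i \<beta> j l k)"
      by (simp add: sum_distrib_left sum_distrib_right mult_ac)
    \<comment> \<open>The swaps bring \<open>i\<close> and \<open>\<beta>\<close> outside and leave
      \<open>j\<close>, \<open>l\<close>, \<open>k\<close> in the order used by
      \<open>\<F>\<close>.\<close>
    also have "\<dots> = (\<Sum>j=1..m. \<Sum>\<beta>=1..n - r. \<Sum>l=1..n. \<Sum>i=1..n. \<Sum>k=1..m. ?T i \<beta> j l k)"
      by (intro sum.cong refl sum.swap)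
    also have "\<dots> = (\<Sum>j=1..m. \<Sum>\<beta>=1..n - r. \<Sum>i=1..n. \<Sum>l=1..n. \<Sum>k=1..m. ?T i \<beta> j l k)"
      by (intro sum.cong refl sum.swap)
    also have "\<dots> = (\<Sum>j=1..m. \<Sum>i=1..n. \<Sum>\<beta>=1..n - r. \<Sum>l=1..n. \<Sum>k=1..m. ?T i \<beta> j l k)"
      by (intro sum.cong refl sum.swap)
    also have "\<dots> = (\<Sum>i=1..n. \<Sum>j=1..m. \<Sum>\<beta>=1..n - r. \<Sum>l=1..n. \<Sum>k=1..m. ?T i \<beta> j l k)"
      by (rule sum.swap)
    also have "\<dots> = (\<Sum>i=1..n. \<Sum>\<beta>=1..n - r. \<Sum>j=1..m. \<Sum>l=1..n. \<Sum>k=1..m. ?T i \<beta> j l k)"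
      by (intro sum.cong refl sum.swap)
    also have "\<dots> = (\<Sum>i=1..n. \<Sum>\<beta>=1..n - r. \<F> i \<alpha> \<beta> \<gamma> * ?q i * w \<beta>)"
      by (simp add: \<F>_def sum_distrib_right)
    finally show ?thesis .
  qed

  define rhs where "rhs \<alpha> w \<gamma> = - (\<Sum>i=1..n. \<Sum>\<beta>=1..n - r. \<B> i \<alpha> \<beta> \<gamma> * p i w \<gamma> * w \<beta>) +
     (\<Sum>j=1..m. \<Sum>k=1..m. \<K> k \<alpha> j \<gamma> * partialL j w \<gamma> * coord m es \<gamma> k)" for \<alpha> w \<gamma>
  define force where "force \<eta> \<gamma> = ad_star br \<eta> (dL_d\<xi> \<eta> \<gamma>) + K_map act (dL_d\<Gamma> \<eta> \<gamma>) \<gamma>" for \<eta> \<gamma>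
  \<comment> \<open>An algebraic identity at a fixed point, with no curve involved: the last term is
    the basis part of the product rule in the direction -\<xi>\<Gamma>.\<close>
  have rhs_eq: "rhs \<alpha> w \<gamma> = blinfun_apply (force (\<xi>c w \<gamma>) \<gamma>) (\<E> \<alpha> \<gamma>) +
      blinfun_apply (dL_d\<xi> (\<xi>c w \<gamma>) \<gamma>) (frechet_derivative (\<E> \<alpha>) (at \<gamma>) (- dual_action act (\<xi>c w \<gamma>) \<gamma>))"
    if \<alpha>: "\<alpha> \<in> {1..n}" for \<alpha> w \<gamma>
  proof -
    have "linear (frechet_derivative (\<E> \<alpha>) (at \<gamma>))"
      using \<E>_differentiable[OF \<alpha>] by (rule linear_frechet_derivative)
    from linear_neg[OF this] show ?thesis
      by (simp add: rhs_def force_def blinfun.add_left blinfun.minus_right ad_star_apply bracket_term K_term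
          frame_term[OF \<alpha>] \<B>_def p_def ring_distribs sum.distrib)
  qed

  \<comment> \<open>Differentiation along the curve\<close>
  have nontrivial: "at t within I \<noteq> bot" if "t \<in> I" for t
  proof -
    \<comment> \<open>An interval with more than one point has no isolated point, so derivatives
      within \<open>I\<close> are unique, also at endpoints.\<close>
    have "\<not> (\<exists>x. I = {x})" using assms(32) by auto
    then show ?thesis
      using connected_imp_perfect[OF is_interval_connected[OF assms(31)] that]
      by (simp add: trivial_limit_within)
  qed
  \<comment> \<open>For the converse direction, the coordinate equations only control the momentum
    on the constraint space. That it has a derivative in all directions must come from smoothness of
    \<open>L\<close> and differentiability of \<xi> and \<Gamma>.\<close>
  have momentum_differentiable: "(\<lambda>t. dL_d\<xi> (\<xi> t) (\<Gamma> t)) differentiable (at t within I)" if t: "t \<in> I" for t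
  proof (rule blinfun_differentiable_componentwise)
    fix b :: 's
    let ?D = "\<lambda>z. frechet_derivative ?L (at z) (b, 0)"
    have "?D differentiable (at (\<xi> t, \<Gamma> t))"
      using smooth_on_imp_differentiable[OF smooth_on_frechet_derivative[OF smL] open_UNIV UNIV_I] .
    then have D: "(?D has_derivative frechet_derivative ?D (at (\<xi> t, \<Gamma> t))) (at (\<xi> t, \<Gamma> t))"
      by (simp only: frechet_derivative_works)
    obtain A B where "(\<xi> has_derivative A) (at t within I)" "(\<Gamma> has_derivative B) (at t within I)"
      using \<xi>diff \<Gamma>diff t unfolding differentiable_on_def differentiable_def by blast
    from has_derivative_compose[OF has_derivative_Pair[OF this] D]
    show "(\<lambda>t. blinfun_apply (dL_d\<xi> (\<xi> t) (\<Gamma> t)) b) differentiable (at t within I)"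
      unfolding dL_d\<xi>_apply by (rule differentiableI)
  qed
  have p_derivative: "((\<lambda>t. p \<alpha> (v t) (\<Gamma> t)) has_real_derivative
        blinfun_apply \<mu>' (\<E> \<alpha> (\<Gamma> t)) +
        blinfun_apply (dL_d\<xi> (\<xi> t) (\<Gamma> t)) (frechet_derivative (\<E> \<alpha>) (at (\<Gamma> t)) \<Gamma>')) (at t within I)"
    if t: "t \<in> I" and \<alpha>: "\<alpha> \<in> {1..n}"
      and \<mu>': "((\<lambda>t. dL_d\<xi> (\<xi> t) (\<Gamma> t)) has_vector_derivative \<mu>') (at t within I)"
      and \<Gamma>': "(\<Gamma> has_vector_derivative \<Gamma>') (at t within I)" for t \<alpha> \<mu>' \<Gamma>'
  proof -
    have D: "(\<E> \<alpha> has_derivative frechet_derivative (\<E> \<alpha>) (at (\<Gamma> t))) (at (\<Gamma> t))"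
      using \<E>_differentiable[OF \<alpha>] by (simp only: frechet_derivative_works)
    have "((\<lambda>t. \<E> \<alpha> (\<Gamma> t)) has_vector_derivative frechet_derivative (\<E> \<alpha>) (at (\<Gamma> t)) \<Gamma>') (at t within I)"
      using has_derivative_compose[OF \<Gamma>'[unfolded has_vector_derivative_def] D]
      by (simp add: has_vector_derivative_def linear_scale[OF has_derivative_linear[OF D]])
    from bounded_bilinear.has_vector_derivative[OF bounded_bilinear_blinfun_apply \<mu>' this]
    have "((\<lambda>t. blinfun_apply (dL_d\<xi> (\<xi> t) (\<Gamma> t)) (\<E> \<alpha> (\<Gamma> t))) has_vector_derivative
        blinfun_apply \<mu>' (\<E> \<alpha> (\<Gamma> t)) +
        blinfun_apply (dL_d\<xi> (\<xi> t) (\<Gamma> t)) (frechet_derivative (\<E> \<alpha>) (at (\<Gamma> t)) \<Gamma>')) (at t within I)"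
      by (simp add: add.commute)
    then show ?thesis
      \<comment> \<open>The identity between \<open>\<xi>\<close> and \<open>\<xi>c\<close> is
        available only on \<open>I\<close>, so the function is replaced within
        \<open>I\<close>.\<close>
      unfolding has_real_derivative_iff_has_vector_derivative
      by (rule has_vector_derivative_transform[OF t, rotated]) (simp add: p_def \<xi>_eq)
  qed

  have \<Gamma>_equation: "(\<Gamma> has_vector_derivative - dual_action act (\<xi> t) (\<Gamma> t)) (at t within I) \<longleftrightarrow>
      (\<forall>i \<in> {1..m}. ((\<lambda>t. coord m es (\<Gamma> t) i) has_real_derivative
          - (\<Sum>\<beta> = 1..n - r. \<Sum>k = 1..m. vk k i \<beta> (\<Gamma> t) * v t \<beta> * coord m es (\<Gamma> t) k)) (at t within I))"
    (is "?lhs \<longleftrightarrow> (\<forall>i \<in> {1..m}. ?comp i)") if t: "t \<in> I" for t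
  proof -
    let ?\<Gamma>' = "- dual_action act (\<xi> t) (\<Gamma> t)"
    have comp: "?comp i \<longleftrightarrow> ((\<lambda>t. blinfun_apply (\<Gamma> t) (e i)) has_vector_derivative blinfun_apply ?\<Gamma>' (e i)) (at t within I)"
      if "i \<in> {1..m}" for i
      using that by (simp add: has_real_derivative_iff_has_vector_derivative coord_es[OF that]
          \<xi>_eq[OF t] blinfun.minus_left dual_action_coord)
    show ?thesis
    proof
      assume ?lhs
      from bounded_linear.has_vector_derivative[OF blinfun.bounded_linear_left this]
      show "\<forall>i \<in> {1..m}. ?comp i" by (simp add: comp)
    next
      assume "\<forall>i \<in> {1..m}. ?comp i"
      then have "((\<lambda>t. blinfun_apply (\<Gamma> t) (e i)) has_vector_derivative blinfun_apply ?\<Gamma>' (e i)) (at t within I)"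
        if "i \<in> {1..m}" for i using comp that by blast
      from bounded_linear.has_vector_derivative[OF bounded_linear_scaleR_left this]
      have "((\<lambda>t. \<Sum>i=1..m. blinfun_apply (\<Gamma> t) (e i) *\<^sub>R es i) has_vector_derivative
          (\<Sum>i=1..m. blinfun_apply ?\<Gamma>' (e i) *\<^sub>R es i)) (at t within I)"
        by (rule has_vector_derivative_sum)
      \<comment> \<open>The componentwise derivatives reassemble, because the sum over the dual
        basis is \<Gamma> itself.\<close>
      then show ?lhs
        unfolding es_def by (simp only: blinfun_eq_sum_dual_basis[OF basise, symmetric])
    qed
  qed

  \<comment> \<open>Elimination of the multipliers\<close>
  have \<E>_in_constraint: "\<E> \<alpha> \<gamma> \<in> constraint_space \<psi> r \<gamma>" if "\<alpha> \<in> {1..n - r}" for \<alpha> \<gamma>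
    unfolding cs using that by (intro span_base imageI)
  have \<xi>_in_constraint: "\<xi> t \<in> constraint_space \<psi> r (\<Gamma> t)" if "t \<in> I" for t
    unfolding cs \<xi>_eq[OF that] \<xi>c_def by (intro span_sum span_scale span_base imageI)
  have le_n: "\<alpha> \<in> {1..n}" if "\<alpha> \<in> {1..n - r}" for \<alpha>
    using that by auto

  \<comment> \<open>The equivalence at a single time. The equation for \<Gamma> is a premise, since
    the velocity of \<Gamma> enters the derivative of \<open>p \<alpha>\<close>.\<close>
  have p_equation: "(\<exists>c :: nat \<Rightarrow> real. ((\<lambda>t. dL_d\<xi> (\<xi> t) (\<Gamma> t)) has_vector_derivative
        force (\<xi> t) (\<Gamma> t) + (\<Sum>a = 1..r. c a *\<^sub>R \<psi> a (\<Gamma> t))) (at t within I)) \<longleftrightarrow>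
      (\<forall>\<alpha> \<in> {1..n - r}. ((\<lambda>t. p \<alpha> (v t) (\<Gamma> t)) has_real_derivative rhs \<alpha> (v t) (\<Gamma> t)) (at t within I))"
    if t: "t \<in> I" and \<Gamma>': "(\<Gamma> has_vector_derivative - dual_action act (\<xi> t) (\<Gamma> t)) (at t within I)" for t
  proof -
    let ?\<gamma> = "\<Gamma> t"
    obtain \<mu>' where \<mu>': "((\<lambda>t. dL_d\<xi> (\<xi> t) (\<Gamma> t)) has_vector_derivative \<mu>') (at t within I)"
      using momentum_differentiable[OF t] vector_derivative_works by blast
    have "(\<exists>c :: nat \<Rightarrow> real. ((\<lambda>t. dL_d\<xi> (\<xi> t) (\<Gamma> t)) has_vector_derivative
        force (\<xi> t) ?\<gamma> + (\<Sum>a = 1..r. c a *\<^sub>R \<psi> a ?\<gamma>)) (at t within I)) \<longleftrightarrow>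
        (\<exists>c :: nat \<Rightarrow> real. \<mu>' = force (\<xi> t) ?\<gamma> + (\<Sum>a = 1..r. c a *\<^sub>R \<psi> a ?\<gamma>))"
      \<comment> \<open>With \<open>\<mu>'\<close> at hand, uniqueness turns the differential
        equation into an equation between covectors.\<close>
      using vector_derivative_unique_within[OF nontrivial[OF t] \<mu>'] \<mu>' by blast
    also have "\<dots> \<longleftrightarrow> (\<exists>c :: nat \<Rightarrow> real. \<mu>' - force (\<xi> t) ?\<gamma> = (\<Sum>a = 1..r. c a *\<^sub>R \<psi> a ?\<gamma>))"
      by (simp only: diff_eq_eq add.commute)
    also have "\<dots> \<longleftrightarrow> (\<forall>x \<in> constraint_space \<psi> r ?\<gamma>. blinfun_apply (\<mu>' - force (\<xi> t) ?\<gamma>) x = 0)"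
    proof
      assume "\<exists>c :: nat \<Rightarrow> real. \<mu>' - force (\<xi> t) ?\<gamma> = (\<Sum>a = 1..r. c a *\<^sub>R \<psi> a ?\<gamma>)"
      then show "\<forall>x \<in> constraint_space \<psi> r ?\<gamma>. blinfun_apply (\<mu>' - force (\<xi> t) ?\<gamma>) x = 0"
        by (elim exE) (simp add: constraint_space_def blinfun.sum_left blinfun.scaleR_left)
    qed (blast intro: annihilator_of_constraint_space)
    also have "\<dots> \<longleftrightarrow> (\<forall>\<alpha> \<in> {1..n - r}. blinfun_apply (\<mu>' - force (\<xi> t) ?\<gamma>) (\<E> \<alpha> ?\<gamma>) = 0)"
    proof
      assume "\<forall>\<alpha> \<in> {1..n - r}. blinfun_apply (\<mu>' - force (\<xi> t) ?\<gamma>) (\<E> \<alpha> ?\<gamma>) = 0"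
      then have "blinfun_apply (\<mu>' - force (\<xi> t) ?\<gamma>) x = 0" if "x \<in> (\<lambda>\<alpha>. \<E> \<alpha> ?\<gamma>) ` {1..n - r}" for x
        using that by blast
      from linear_eq_0_on_span[OF bounded_linear.linear[OF blinfun.bounded_linear_right] this]
      show "\<forall>x \<in> constraint_space \<psi> r ?\<gamma>. blinfun_apply (\<mu>' - force (\<xi> t) ?\<gamma>) x = 0"
        unfolding cs by blast
    qed (use \<E>_in_constraint in blast)
    also have "\<dots> \<longleftrightarrow> (\<forall>\<alpha> \<in> {1..n - r}. ((\<lambda>t. p \<alpha> (v t) (\<Gamma> t)) has_real_derivative rhs \<alpha> (v t) ?\<gamma>) (at t within I))"
    proof (rule ball_cong[OF refl])
      fix \<alpha> assume "\<alpha> \<in> {1..n - r}"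
      then have \<alpha>: "\<alpha> \<in> {1..n}" by (rule le_n)
      let ?D = "blinfun_apply (dL_d\<xi> (\<xi> t) ?\<gamma>) (frechet_derivative (\<E> \<alpha>) (at ?\<gamma>) (- dual_action act (\<xi> t) ?\<gamma>))"
      have "((\<lambda>t. p \<alpha> (v t) (\<Gamma> t)) has_real_derivative rhs \<alpha> (v t) ?\<gamma>) (at t within I) \<longleftrightarrow>
          rhs \<alpha> (v t) ?\<gamma> = blinfun_apply \<mu>' (\<E> \<alpha> ?\<gamma>) + ?D"
        using p_derivative[OF t \<alpha> \<mu>' \<Gamma>'] vector_derivative_unique_within[OF nontrivial[OF t]]
        unfolding has_real_derivative_iff_has_vector_derivative by metis
      \<comment> \<open>By \<open>rhs_eq\<close> the basis term \<open>?D\<close> occurs on both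
        sides and cancels.\<close>
      also have "\<dots> \<longleftrightarrow> blinfun_apply (\<mu>' - force (\<xi> t) ?\<gamma>) (\<E> \<alpha> ?\<gamma>) = 0"
        unfolding rhs_eq[OF \<alpha>] \<xi>_eq[OF t, symmetric] by (auto simp: blinfun.diff_left)
      finally show "blinfun_apply (\<mu>' - force (\<xi> t) ?\<gamma>) (\<E> \<alpha> ?\<gamma>) = 0 \<longleftrightarrow>
          ((\<lambda>t. p \<alpha> (v t) (\<Gamma> t)) has_real_derivative rhs \<alpha> (v t) ?\<gamma>) (at t within I)" ..
    qed
    finally show ?thesis .
  qed

  let ?EP = "\<lambda>c t. ((\<lambda>t. dL_d\<xi> (\<xi> t) (\<Gamma> t)) has_vector_derivative
        force (\<xi> t) (\<Gamma> t) + (\<Sum>a = 1..r. c a *\<^sub>R \<psi> a (\<Gamma> t))) (at t within I)"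
  let ?\<Gamma>EQ = "\<lambda>t. (\<Gamma> has_vector_derivative - dual_action act (\<xi> t) (\<Gamma> t)) (at t within I)"
  have "(\<exists>lam :: nat \<Rightarrow> real \<Rightarrow> real. \<forall>t \<in> I. ?EP (\<lambda>a. lam a t) t \<and> ?\<Gamma>EQ t \<and> \<xi> t \<in> constraint_space \<psi> r (\<Gamma> t))
      \<longleftrightarrow> (\<forall>t \<in> I. \<exists>c :: nat \<Rightarrow> real. ?EP c t \<and> ?\<Gamma>EQ t)"
  proof
    assume "\<exists>lam :: nat \<Rightarrow> real \<Rightarrow> real. \<forall>t \<in> I. ?EP (\<lambda>a. lam a t) t \<and> ?\<Gamma>EQ t \<and> \<xi> t \<in> constraint_space \<psi> r (\<Gamma> t)"
    then obtain lam where "\<forall>t \<in> I. ?EP (\<lambda>a. lam a t) t \<and> ?\<Gamma>EQ t \<and> \<xi> t \<in> constraint_space \<psi> r (\<Gamma> t)" ..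
    then have "?EP (\<lambda>a. lam a t) t \<and> ?\<Gamma>EQ t" if "t \<in> I" for t
      using that by simp
    then show "\<forall>t \<in> I. \<exists>c :: nat \<Rightarrow> real. ?EP c t \<and> ?\<Gamma>EQ t"
      by (intro ballI exI)
  next
    assume "\<forall>t \<in> I. \<exists>c :: nat \<Rightarrow> real. ?EP c t \<and> ?\<Gamma>EQ t"
    \<comment> \<open>The multipliers are arbitrary functions of time, so choosing them separately
      at each \<open>t\<close> suffices.\<close>
    from bchoice[OF this] obtain c where "\<forall>t \<in> I. ?EP (c t) t \<and> ?\<Gamma>EQ t" ..
    then show "\<exists>lam :: nat \<Rightarrow> real \<Rightarrow> real. \<forall>t \<in> I. ?EP (\<lambda>a. lam a t) t \<and> ?\<Gamma>EQ t \<and> \<xi> t \<in> constraint_space \<psi> r (\<Gamma> t)"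
      using \<xi>_in_constraint by (intro exI[of _ "\<lambda>a t. c t a"]) simp
  qed
  also have "\<dots> \<longleftrightarrow> (\<forall>t \<in> I. (\<forall>\<alpha> \<in> {1..n - r}. ((\<lambda>t. p \<alpha> (v t) (\<Gamma> t)) has_real_derivative
      rhs \<alpha> (v t) (\<Gamma> t)) (at t within I)) \<and> ?\<Gamma>EQ t)"
  proof (rule ball_cong[OF refl])
    fix t assume "t \<in> I"
    \<comment> \<open>The premise of \<open>p_equation\<close> is available as the conjunct common
      to both sides.\<close>
    from p_equation[OF this] show "(\<exists>c :: nat \<Rightarrow> real. ?EP c t \<and> ?\<Gamma>EQ t) \<longleftrightarrow>
      (\<forall>\<alpha> \<in> {1..n - r}. ((\<lambda>t. p \<alpha> (v t) (\<Gamma> t)) has_real_derivative rhs \<alpha> (v t) (\<Gamma> t)) (at t within I)) \<and> ?\<Gamma>EQ t"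
      by (simp only: ex_simps cong: conj_cong) argo
  qed
  finally show ?thesis
    unfolding force_def rhs_def by (simp only: \<Gamma>_equation cong: ball_cong)
qed

end
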